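(* Let $P$ be a pure contraction on a Hilbert space $\mathcal{H}$. Let $F\in\mathcal{B}(\mathcal{D}_P)$ and $G\in\mathcal{B}(\mathcal{D}_{P^*})$ be operators with numerical radii $w(F)\le 1$ and $w(G)\le 1$. If $$\Theta_P(z)(F+F^*z)=(G^*+Gz)\Theta_P(z)\quad\text{for all } z\in\mathbb{D},$$ then there exists an operator $S$ on $\mathcal{H}$ such that $(S,P)$ is a $\Gamma$-contraction, $F$ is the fundamental operator of $(S,P)$ and $G$ is the fundamental operator of $(S^*,P^* )$.
   Context: A contraction $P$ is pure if $P^{*n}\to 0$ strongly as $n\to\infty$. The symmetrized bidisc is $\Gamma=\{(z_1+z_2,z_1z_2):|z_1|,|z_2|\le 1\}$. A $\Gamma$-contraction is a commuting pair $(S,P)$ of bounded operators on a Hilbert space having $\Gamma$ as a spectral set. For a contraction $P$, $D_P=(I-P^*P)^{1/2}$, $\mathcal{D}_P=\overline{\operatorname{Ran}}\,D_P$, and similarly $D_{P^*}$, $\mathcal{D}_{P^*}$. The fundamental operator of a $\Gamma$-contraction $(S,P)$ is the unique $F\in\mathcal{B}(\mathcal{D}_P)$ with $S-S^*P=D_PFD_P$. The characteristic function of $P$ is $\Theta_P(z)=[-P+zD_{P^*}(I-zP^* )^{-1}D_P]|_{\mathcal{D}_P}$, $z\in\mathbb{D}$. $w(\cdot)$ denotes numerical radius. *)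

theory Defs
  imports "HOL-Analysis.Analysis"
begin

text \<open>A complex Hilbert space is encoded as a real Hilbert space (real inner product space,
complete) together with an orthogonal complex structure cJ (multiplication by the imaginary
unit): cJ is real-linear, cJ (cJ x) = -x and cJ preserves the real inner product.
The real inner product is the real part of the complex inner product.\<close>

class chilbert = real_inner + complete_space +
  fixes cJ :: "'a \<Rightarrow> 'a"
  assumes cJ_add: "cJ (x + y) = cJ x + cJ y"
    and cJ_scaleR: "cJ (r *\<^sub>R x) = r *\<^sub>R cJ x"
    and cJ_cJ: "cJ (cJ x) = - x"
    and cJ_inner: "inner (cJ x) (cJ y) = inner x y"

definition scaleC :: "complex \<Rightarrow> 'a::chilbert \<Rightarrow> 'a" where
  "scaleC c x = Re c *\<^sub>R x + Im c *\<^sub>R cJ x"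

text \<open>Complex inner product, linear in the first argument, conjugate-linear in the second.\<close>
definition cinner :: "'a::chilbert \<Rightarrow> 'a \<Rightarrow> complex" where
  "cinner x y = Complex (inner x y) (inner x (cJ y))"

definition cbl :: "('a::chilbert \<Rightarrow> 'a) \<Rightarrow> bool" where
  "cbl T \<longleftrightarrow> (\<forall>x y. T (x + y) = T x + T y) \<and> (\<forall>c x. T (scaleC c x) = scaleC c (T x))
     \<and> (\<exists>K. \<forall>x. norm (T x) \<le> K * norm x)"

definition adj :: "('a::chilbert \<Rightarrow> 'a) \<Rightarrow> ('a \<Rightarrow> 'a)" where
  "adj T = (THE T'. \<forall>x y. cinner (T x) y = cinner x (T' y))"

definition op_sqrt :: "('a::chilbert \<Rightarrow> 'a) \<Rightarrow> ('a \<Rightarrow> 'a)" where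
  "op_sqrt A = (THE B. cbl B \<and> (\<forall>x. Im (cinner (B x) x) = 0 \<and> Re (cinner (B x) x) \<ge> 0)
                      \<and> (\<forall>x. B (B x) = A x))"

definition defect :: "('a::chilbert \<Rightarrow> 'a) \<Rightarrow> ('a \<Rightarrow> 'a)" where
  "defect P = op_sqrt (\<lambda>x. x - adj P (P x))"

definition defect_space :: "('a::chilbert \<Rightarrow> 'a) \<Rightarrow> 'a set" where
  "defect_space P = closure (range (defect P))"

definition contraction :: "('a::chilbert \<Rightarrow> 'a) \<Rightarrow> bool" where
  "contraction P \<longleftrightarrow> cbl P \<and> (\<forall>x. norm (P x) \<le> norm x)"

definition pure_contraction :: "('a::chilbert \<Rightarrow> 'a) \<Rightarrow> bool" where
  "pure_contraction P \<longleftrightarrow> contraction P \<and> (\<forall>x. (\<lambda>n. (adj P ^^ n) x) \<longlonglongrightarrow> 0)"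

text \<open>F is a bounded complex-linear operator on the (closed) subspace M, i.e. an element of B(M);
  the values of F outside M are irrelevant.\<close>
definition sub_op :: "'a::chilbert set \<Rightarrow> ('a \<Rightarrow> 'a) \<Rightarrow> bool" where
  "sub_op M F \<longleftrightarrow> (\<forall>x\<in>M. F x \<in> M) \<and> (\<forall>x\<in>M. \<forall>y\<in>M. F (x + y) = F x + F y)
     \<and> (\<forall>c. \<forall>x\<in>M. F (scaleC c x) = scaleC c (F x))
     \<and> (\<exists>K. \<forall>x\<in>M. norm (F x) \<le> K * norm x)"

definition sub_adj :: "'a::chilbert set \<Rightarrow> ('a \<Rightarrow> 'a) \<Rightarrow> ('a \<Rightarrow> 'a)" where
  "sub_adj M F y = (THE u. u \<in> M \<and> (\<forall>x\<in>M. cinner (F x) y = cinner x u))"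

text \<open>Numerical radius of F in B(M) (0 if M is the zero space).\<close>
definition num_radius :: "'a::chilbert set \<Rightarrow> ('a \<Rightarrow> 'a) \<Rightarrow> real" where
  "num_radius M F = Sup (insert 0 {cmod (cinner (F x) x) | x. x \<in> M \<and> norm x = 1})"

definition char_fun :: "('a::chilbert \<Rightarrow> 'a) \<Rightarrow> complex \<Rightarrow> 'a \<Rightarrow> 'a" where
  "char_fun P z x = - P x + scaleC z (defect (adj P)
      (inv (\<lambda>y. y - scaleC z (adj P y)) (defect P x)))"

definition Gamma_set :: "(complex \<times> complex) set" where
  "Gamma_set = {(z1 + z2, z1 * z2) | z1 z2. cmod z1 \<le> 1 \<and> cmod z2 \<le> 1}"

definition poly2_eval :: "(nat \<Rightarrow> nat \<Rightarrow> complex) \<Rightarrow> nat \<Rightarrow> complex \<Rightarrow> complex \<Rightarrow> complex" where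
  "poly2_eval c N s p = (\<Sum>i\<le>N. \<Sum>j\<le>N. c i j * s ^ i * p ^ j)"

definition poly2_op :: "(nat \<Rightarrow> nat \<Rightarrow> complex) \<Rightarrow> nat \<Rightarrow> ('a::chilbert \<Rightarrow> 'a) \<Rightarrow> ('a \<Rightarrow> 'a) \<Rightarrow> 'a \<Rightarrow> 'a" where
  "poly2_op c N S P x = (\<Sum>i\<le>N. \<Sum>j\<le>N. scaleC (c i j) ((S ^^ i) ((P ^^ j) x)))"

definition poly2_sup :: "(nat \<Rightarrow> nat \<Rightarrow> complex) \<Rightarrow> nat \<Rightarrow> real" where
  "poly2_sup c N = Sup ((\<lambda>(s, p). cmod (poly2_eval c N s p)) ` Gamma_set)"

text \<open>(S,P) commuting bounded operators with Gamma a spectral set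
  (von Neumann inequality for all polynomials; Gamma is polynomially convex).\<close>
definition gamma_contraction :: "('a::chilbert \<Rightarrow> 'a) \<Rightarrow> ('a \<Rightarrow> 'a) \<Rightarrow> bool" where
  "gamma_contraction S P \<longleftrightarrow> cbl S \<and> cbl P \<and> (\<forall>x. S (P x) = P (S x)) \<and>
     (\<forall>c N x. norm (poly2_op c N S P x) \<le> poly2_sup c N * norm x)"

definition fund_op :: "('a::chilbert \<Rightarrow> 'a) \<Rightarrow> ('a \<Rightarrow> 'a) \<Rightarrow> ('a \<Rightarrow> 'a) \<Rightarrow> bool" where
  "fund_op S P F \<longleftrightarrow> sub_op (defect_space P) F \<and>
     (\<forall>x. S x - adj S (P x) = defect P (F (defect P x)))"

end

(* A pure contraction embeds isometrically in the vector-valued Hardy space by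
   h |-> (D_* P*^n h)_n, intertwining P* with the backward shift. The intertwining relation makes the
   range invariant under the adjoint of multiplication by G* + Gz, and S* is the restriction; concretely
     S* h = sum_m P^m D_* (G D_* P*^m h + G* D_* P*^(m+1) h).
   Comparing Taylor coefficients of the relation and telescoping gives D S* = F* D + P* G* D_*, and both
   fundamental equations follow algebraically. Gamma is a spectral set because (S, P) is a compression
   of multiplication by (G* + Gz, z): by a discrete Fourier transform it suffices to bound polynomials
   at each |z| = 1, where G* + Gz is a unimodular multiple of a self-adjoint operator with numerical
   range in [-2, 2]. *)

theory Submission
  imports Defs "HOL-Computational_Algebra.Fundamental_Theorem_Algebra"
begin


text \<open>Adjoints, projections and square roots are built for the real inner product; an adjoint
  identity for the real part gives the complex one as soon as the operators commute with
  \<open>cJ\<close>.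

  The Hardy space itself is never constructed. With Q the adjoint of P and D, E the defect operators
  of P and Q, what is used of the embedding is that \<open>h \<mapsto> (E Q^m h)_m\<close> and its
  adjoint \<open>(g_m) \<mapsto> \<Sum> P^m E g_m\<close> are contractions for the l2 norm. The
  series for the adjoint of S is a synthesis of this kind, so by definition it is only a
  compression. That it is a restriction is a separate identity, \<open>E_T\<close>, which rests on
  the intertwining relation.

  F and G live on the defect spaces only. They are extended by zero on the orthogonal complements,
  which is compatible with adjoints and with the quadratic bound from the numerical radius.\<close>

instance chilbert \<subseteq> banach ..

section \<open>Complex structure on a real Hilbert space and bounded complex-linear maps\<close>

lemma cJ_zero [simp]: "cJ 0 = (0::'a::chilbert)"
  using cJ_scaleR[of 0 "0::'a"] by simp

lemma cJ_minus: "cJ (- x) = - cJ (x::'a::chilbert)"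
  using cJ_scaleR[of "-1" x] by simp

lemma cJ_diff: "cJ (x - y) = cJ x - cJ (y::'a::chilbert)"
  using cJ_add[of x "- y"] by (simp add: cJ_minus)

lemma norm_cJ [simp]: "norm (cJ x) = norm (x::'a::chilbert)"
  by (simp add: norm_eq_sqrt_inner cJ_inner)

lemma bounded_linear_cJ: "bounded_linear (cJ :: 'a::chilbert \<Rightarrow> 'a)"
  by (rule bounded_linear_intro[where K=1]) (simp_all add: cJ_add cJ_scaleR)

lemma inner_cJ_left: "inner (cJ x) y = - inner x (cJ (y::'a::chilbert))"
  using cJ_inner[of x "cJ y"] by (simp add: cJ_cJ)

lemma inner_cJ_self [simp]: "inner x (cJ x) = 0" "inner (cJ x) (x::'a::chilbert) = 0"
  using inner_cJ_left[of x x] by (simp_all add: inner_commute)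

interpretation scaleC: vector_space "scaleC :: complex \<Rightarrow> 'a::chilbert \<Rightarrow> 'a"
proof
  fix a b :: complex and x y :: 'a
  show "scaleC a (x + y) = scaleC a x + scaleC a y"
    by (simp add: scaleC_def cJ_add algebra_simps)
  show "scaleC (a + b) x = scaleC a x + scaleC b x"
    by (simp add: scaleC_def algebra_simps)
  show "scaleC a (scaleC b x) = scaleC (a * b) x"
    by (simp add: scaleC_def cJ_add cJ_scaleR cJ_cJ algebra_simps)
  show "scaleC 1 x = x"
    by (simp add: scaleC_def)
qed

lemma scaleC_of_real [simp]: "scaleC (of_real r) x = r *\<^sub>R x"
  by (simp add: scaleC_def)

lemma inner_scaleC_left: "inner (scaleC c x) y = inner x (scaleC (cnj c) y)"
  by (simp add: scaleC_def inner_add_left inner_add_right inner_diff_right inner_cJ_left)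

lemma inner_scaleC_right: "inner x (scaleC c y) = inner (scaleC (cnj c) x) y"
  by (simp add: inner_scaleC_left)

lemma norm_scaleC: "norm (scaleC c x) = cmod c * norm x"
proof -
  have "inner (scaleC c x) (scaleC c x) = inner x (scaleC (cnj c * c) x)"
    by (simp add: inner_scaleC_left)
  also have "cnj c * c = of_real ((cmod c)\<^sup>2)"
    by (metis complex_norm_square mult.commute)
  finally have "(norm (scaleC c x))\<^sup>2 = (cmod c * norm x)\<^sup>2"
    by (simp only: scaleC_of_real) (simp add: power2_norm_eq_inner power_mult_distrib)
  thus ?thesis
    by (simp add: power2_eq_iff_nonneg)
qed

lemma bounded_linear_scaleC: "bounded_linear (scaleC c :: 'a::chilbert \<Rightarrow> 'a)"
  unfolding scaleC_def
  by (intro bounded_linear_add bounded_linear_scaleR_right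
        bounded_linear_compose[OF bounded_linear_scaleR_right bounded_linear_cJ])

text \<open>The scalar i acts as \<open>cJ\<close>, so complex linearity is real linearity plus
  commuting with \<open>cJ\<close>. The theory of \<open>bounded_linear\<close> thereby
  applies.\<close>

lemma cbl_iff: "cbl T \<longleftrightarrow> bounded_linear T \<and> (\<forall>x. T (cJ x) = cJ (T x))"
proof
  assume T: "cbl T"
  obtain K where K: "\<And>x. norm (T x) \<le> K * norm x"
    using T by (auto simp: cbl_def)
  have sc: "T (scaleC c x) = scaleC c (T x)" for c x
    using T by (auto simp: cbl_def)
  have J: "T (cJ x) = cJ (T x)" for x
    using sc[of \<i> x] by (simp add: scaleC_def)
  have "bounded_linear T"
  proof (rule bounded_linear_intro[where K=K])
    show "T (x + y) = T x + T y" for x y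
      using T by (auto simp: cbl_def)
    show "T (r *\<^sub>R x) = r *\<^sub>R T x" for r x
      using sc[of "of_real r" x] by simp
    show "norm (T x) \<le> norm x * K" for x
      using K[of x] by (simp add: mult.commute)
  qed
  with J show "bounded_linear T \<and> (\<forall>x. T (cJ x) = cJ (T x))"
    by blast
next
  assume T: "bounded_linear T \<and> (\<forall>x. T (cJ x) = cJ (T x))"
  then interpret bounded_linear T by blast
  show "cbl T"
    unfolding cbl_def scaleC_def
    using T bounded by (auto simp: add scaleR mult.commute)
qed

lemma cbl_bounded_linear: "cbl T \<Longrightarrow> bounded_linear T"
  by (simp add: cbl_iff)

lemma cbl_cJ: "cbl T \<Longrightarrow> T (cJ x) = cJ (T x)"
  by (simp add: cbl_iff)

lemma cbl_scaleC: "cbl T \<Longrightarrow> T (scaleC c x) = scaleC c (T x)"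
  by (simp add: cbl_def)

lemmas cbl_add = linear_add[OF bounded_linear.linear[OF cbl_bounded_linear]]
  and cbl_diff = linear_diff[OF bounded_linear.linear[OF cbl_bounded_linear]]
  and cbl_neg = linear_neg[OF bounded_linear.linear[OF cbl_bounded_linear]]
  and cbl_zero = linear_0[OF bounded_linear.linear[OF cbl_bounded_linear]]
  and cbl_scaleR = linear_scale[OF bounded_linear.linear[OF cbl_bounded_linear]]
  and cbl_sum = linear_sum[OF bounded_linear.linear[OF cbl_bounded_linear]]
  and cbl_tendsto = bounded_linear.tendsto[OF cbl_bounded_linear]

lemma cbl_compose: "cbl S \<Longrightarrow> cbl T \<Longrightarrow> cbl (\<lambda>x. S (T x))"
  by (simp add: cbl_iff bounded_linear_compose)

lemma cbl_plus: "cbl S \<Longrightarrow> cbl T \<Longrightarrow> cbl (\<lambda>x. S x + T x)"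
  by (simp add: cbl_iff bounded_linear_add cJ_add)

lemma cbl_minus: "cbl S \<Longrightarrow> cbl T \<Longrightarrow> cbl (\<lambda>x. S x - T x)"
  by (simp add: cbl_iff bounded_linear_sub cJ_diff)

lemma cbl_scaleC_compose: "cbl S \<Longrightarrow> cbl (\<lambda>x. scaleC c (S x))"
  using bounded_linear_compose[OF bounded_linear_scaleC[of c], of S]
  by (auto simp: cbl_iff scaleC_def cJ_add cJ_scaleR)

lemma cbl_id: "cbl (\<lambda>x. x)"
  by (simp add: cbl_iff)

lemma cbl_0: "cbl (\<lambda>x. 0)"
  by (simp add: cbl_iff)

lemma cbl_sum_fun: "finite A \<Longrightarrow> (\<And>i. i \<in> A \<Longrightarrow> cbl (U i)) \<Longrightarrow> cbl (\<lambda>x. \<Sum>i\<in>A. U i x)"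
  by (induction A rule: finite_induct) (simp_all add: cbl_0 cbl_plus)

lemma cbl_funpow: "cbl T \<Longrightarrow> cbl (T ^^ n)"
  by (induction n) (auto simp: cbl_id[unfolded id_def[symmetric]] o_def intro: cbl_compose)

lemma cbl_pos_bound: "cbl T \<Longrightarrow> \<exists>K>0. \<forall>x. norm (T x) \<le> K * norm x"
  using bounded_linear.pos_bounded[OF cbl_bounded_linear, of T] by (auto simp: mult.commute)

lemma funpow_intertwine:
  assumes "\<And>x. X (A x) = B (X x)"
  shows "X ((A ^^ n) x) = (B ^^ n) (X x)"
  by (induction n) (simp_all add: assms)

subsection \<open>Riesz representation and adjoints\<close>

text \<open>Variational proof: \<open>J\<close> is bounded below by completing the square, the
  parallelogram law makes a minimising sequence Cauchy, and the first-order condition at the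
  minimiser is the claim. Working on a closed subspace yields orthogonal projections as well as
  adjoints.\<close>

lemma riesz_subspace:
  fixes M :: "'a::{real_inner, complete_space} set"
  assumes M: "subspace M" "closed M" and \<phi>: "bounded_linear \<phi>"
  shows "\<exists>u\<in>M. \<forall>y\<in>M. inner u y = \<phi> y"
proof -
  interpret \<phi>: bounded_linear \<phi> by fact
  obtain K where K: "\<And>x. \<bar>\<phi> x\<bar> \<le> norm x * K"
    using \<phi>.bounded by auto
  define J where "J y = inner y y - 2 * \<phi> y" for y
  have J_ge: "J y \<ge> - K\<^sup>2" for y
  proof -
    have "J y \<ge> (norm y)\<^sup>2 - 2 * (norm y * K)"
      using K[of y] by (simp add: J_def power2_norm_eq_inner abs_le_iff)
    moreover have "(norm y - K)\<^sup>2 \<ge> 0" by simp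
    ultimately show ?thesis by (simp add: power2_eq_square algebra_simps)
  qed
  define d where "d = Inf (J ` M)"
  have bdd: "bdd_below (J ` M)"
    by (rule bdd_belowI2[of _ "- K\<^sup>2"]) (rule J_ge)
  have ne: "J ` M \<noteq> {}"
    using subspace_0[OF M(1)] by auto
  have d_le: "d \<le> J y" if "y \<in> M" for y
    unfolding d_def using bdd that by (auto intro: cInf_lower)
  have "\<exists>y\<in>M. J y < d + 1 / real (Suc n)" for n
    using cInf_lessD[OF ne, of "d + 1 / real (Suc n)"] by (auto simp: d_def)
  then obtain y where y: "\<And>n. y n \<in> M" "\<And>n. J (y n) < d + 1 / real (Suc n)"
    by metis
  have para: "(norm (y m - y n))\<^sup>2 \<le> 2 / real (Suc m) + 2 / real (Suc n)" for m n
  proof -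
    have "(1/2) *\<^sub>R (y m + y n) \<in> M"
      using y(1) M(1) by (simp add: subspace_add subspace_scale)
    hence "d \<le> J ((1/2) *\<^sub>R (y m + y n))" by (rule d_le)
    moreover have "(norm (y m - y n))\<^sup>2 = 2 * J (y m) + 2 * J (y n) - 4 * J ((1/2) *\<^sub>R (y m + y n))"
      unfolding J_def power2_norm_eq_inner
      by (simp add: \<phi>.scaleR \<phi>.add inner_add_left inner_add_right inner_diff_left inner_diff_right
          inner_commute field_simps)
    ultimately show ?thesis using y(2)[of m] y(2)[of n] by simp
  qed
  have "Cauchy y"
  proof (rule metric_CauchyI)
    fix e :: real assume e: "e > 0"
    obtain N where N: "1 / real (Suc N) < e\<^sup>2 / 4"
      using nat_approx_posE[of "e\<^sup>2/4"] e by auto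
    have "dist (y m) (y n) < e" if "m \<ge> N" "n \<ge> N" for m n
    proof -
      have "1 / real (Suc m) \<le> 1 / real (Suc N)" "1 / real (Suc n) \<le> 1 / real (Suc N)"
        using that by (simp_all add: frac_le)
      hence "(norm (y m - y n))\<^sup>2 < e\<^sup>2"
        using para[of m n] N by simp
      thus ?thesis
        using e by (simp add: dist_norm power_less_imp_less_base)
    qed
    thus "\<exists>N. \<forall>m\<ge>N. \<forall>n\<ge>N. dist (y m) (y n) < e" by blast
  qed
  then obtain u where u: "y \<longlonglongrightarrow> u"
    using Cauchy_convergent convergent_def by blast
  have uM: "u \<in> M"
    using M(2) y(1) u closed_sequentially by blast
  have "(\<lambda>n. J (y n)) \<longlonglongrightarrow> J u"
    unfolding J_def by (intro tendsto_intros u \<phi>.tendsto)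
  moreover have "(\<lambda>n. d + 1 / real (Suc n)) \<longlonglongrightarrow> d + 0"
    by (intro tendsto_intros LIMSEQ_Suc[OF lim_1_over_n])
  ultimately have Ju: "J u \<le> d"
    using y(2) by (auto intro: LIMSEQ_le less_imp_le)
  have "inner u v = \<phi> v" if v: "v \<in> M" for v
  proof -
    define b where "b = inner u v - \<phi> v"
    have q: "0 \<le> 2 * t * b + t\<^sup>2 * inner v v" for t
    proof -
      have "u + t *\<^sub>R v \<in> M"
        using uM v M(1) by (simp add: subspace_add subspace_scale)
      hence "J u \<le> J (u + t *\<^sub>R v)"
        using d_le Ju by force
      thus ?thesis
        by (simp add: J_def b_def \<phi>.scaleR \<phi>.add inner_add_left inner_add_right inner_commute
            power2_eq_square algebra_simps)
    qed
    \<comment> \<open>The extra 1 keeps \<open>c\<close> positive when \<open>v\<close> = 0; the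
      value t = -b/c still makes the quadratic negative unless b = 0.\<close>
    define c where "c = inner v v + 1"
    have c: "c > 0" by (simp add: c_def add_nonneg_pos)
    have "0 \<le> 2 * (- b / c) * b + (- b / c)\<^sup>2 * inner v v"
      by (rule q)
    also have "\<dots> \<le> 2 * (- b / c) * b + (- b / c)\<^sup>2 * c"
      by (intro add_left_mono mult_left_mono) (auto simp: c_def)
    also have "\<dots> = - (b\<^sup>2 / c)"
      using c by (simp add: power2_eq_square field_simps)
    finally have "b\<^sup>2 / c \<le> 0" by simp
    hence "b = 0"
      using c by (simp add: divide_le_0_iff)
    thus ?thesis by (simp add: b_def)
  qed
  with uM show ?thesis by blast
qed

lemma inner_ext: "(\<And>y. inner x y = inner z y) \<Longrightarrow> x = (z::'a::real_inner)"
  by (rule vector_eq_rdot[THEN iffD1]) simp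

lemma cinner_eq_iff: "cinner x y = cinner x' y' \<longleftrightarrow> inner x y = inner x' y' \<and> inner x (cJ y) = inner x' (cJ y')"
  by (simp add: cinner_def)

lemma adj_exists:
  assumes "cbl T"
  shows "\<exists>T'. cbl T' \<and> (\<forall>x y. inner (T x) y = inner x (T' y))"
proof -
  interpret bounded_linear T using assms by (rule cbl_bounded_linear)
  have "\<exists>u. \<forall>x. inner u x = inner (T x) y" for y
    using riesz_subspace[OF subspace_UNIV closed_UNIV, of "\<lambda>x. inner (T x) y"]
      bounded_linear_inner_left_comp[OF bounded_linear_axioms] by auto
  then obtain T' where T': "\<And>y x. inner (T' y) x = inner (T x) y"
    by metis
  obtain K where K: "K > 0" "\<And>x. norm (T x) \<le> norm x * K"
    using pos_bounded by auto
  have "bounded_linear T'"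
  proof (rule bounded_linear_intro[where K=K])
    show "T' (x + y) = T' x + T' y" for x y
      by (rule inner_ext) (simp add: T' inner_add_left inner_add_right)
    show "T' (r *\<^sub>R x) = r *\<^sub>R T' x" for r x
      by (rule inner_ext) (simp add: T')
    show "norm (T' x) \<le> norm x * K" for x
    proof -
      have "(norm (T' x))\<^sup>2 = inner (T (T' x)) x"
        by (simp add: power2_norm_eq_inner T')
      also have "\<dots> \<le> norm (T (T' x)) * norm x"
        by (rule norm_cauchy_schwarz)
      also have "\<dots> \<le> norm (T' x) * K * norm x"
        by (intro mult_right_mono K) auto
      finally have "norm (T' x) * norm (T' x) \<le> norm (T' x) * (norm x * K)"
        by (simp add: power2_eq_square mult_ac)
      thus ?thesis
        using K(1) by (cases "norm (T' x) = 0") (auto simp: mult_nonneg_nonneg)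
    qed
  qed
  moreover have "T' (cJ x) = cJ (T' x)" for x
    by (rule inner_ext) (simp add: T' inner_cJ_left cbl_cJ[OF assms])
  ultimately have "cbl T'" by (simp add: cbl_iff)
  moreover have "inner (T x) y = inner x (T' y)" for x y
    by (metis T' inner_commute)
  ultimately show ?thesis by metis
qed

text \<open>\<open>adj\<close> is defined through \<open>cinner\<close>, whose imaginary part is the
  real inner product at \<open>cJ y\<close>. Real adjoints are unique, and the one from
  \<open>adj_exists\<close> commutes with \<open>cJ\<close>, so the real identity alone determines
  \<open>adj T\<close>.\<close>

lemma adj_eqI:
  assumes "cbl T" "\<And>x y. inner (T x) y = inner x (T' y)"
  shows "adj T = T'"
  unfolding adj_def
proof (rule the_equality)
  from adj_exists[OF assms(1)]
  obtain S where "cbl S \<and> (\<forall>x y. inner (T x) y = inner x (S y))" ..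
  hence S: "cbl S" "\<And>x y. inner (T x) y = inner x (S y)"
    by simp_all
  have eq: "U = S" if U: "\<And>x y. inner (T x) y = inner x (U y)" for U
  proof (rule ext, rule inner_ext)
    show "inner (U y) x = inner (S y) x" for x y
      using U[of x y] S(2)[of x y] by (metis inner_commute)
  qed
  have T': "T' = S"
    using assms(2) by (rule eq)
  show "\<forall>x y. cinner (T x) y = cinner x (T' y)"
    by (simp add: T' cinner_eq_iff S(2) cbl_cJ[OF S(1)])
  show "U = T'" if "\<forall>x y. cinner (T x) y = cinner x (U y)" for U
    unfolding T' by (rule eq) (use that in \<open>simp add: cinner_eq_iff\<close>)
qed

lemma
  assumes "cbl T"
  shows cbl_adj: "cbl (adj T)"
    and inner_adj_right: "inner x (adj T y) = inner (T x) y"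
    and inner_adj_left: "inner (adj T x) y = inner x (T y)"
proof -
  from adj_exists[OF assms(1)]
  obtain S where "cbl S \<and> (\<forall>x y. inner (T x) y = inner x (S y))" ..
  hence S: "cbl S" "\<And>x y. inner (T x) y = inner x (S y)"
    by simp_all
  have "adj T = S"
    using assms S(2) by (rule adj_eqI)
  with S(1) S(2)[of x y] S(2)[of y x]
  show "cbl (adj T)" "inner x (adj T y) = inner (T x) y" "inner (adj T x) y = inner x (T y)"
    by (metis inner_commute)+
qed

lemma adj_adj: "cbl T \<Longrightarrow> adj (adj T) = T"
  by (rule adj_eqI) (auto simp: cbl_adj inner_adj_left)

lemma norm_adj_le:
  assumes "cbl T" "\<And>x. norm (T x) \<le> K * norm x"
  shows "norm (adj T x) \<le> K * norm x"
proof -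
  have "norm (adj T x) * norm (adj T x) = inner (T (adj T x)) x"
    using inner_adj_right[OF assms(1), of "adj T x" x] by (simp add: dot_square_norm power2_eq_square)
  also have "\<dots> \<le> norm (T (adj T x)) * norm x"
    by (rule norm_cauchy_schwarz)
  also have "\<dots> \<le> K * norm (adj T x) * norm x"
    by (intro mult_right_mono assms) auto
  finally have "norm (adj T x) * norm (adj T x) \<le> norm (adj T x) * (K * norm x)"
    by (simp add: mult_ac)
  moreover have "0 \<le> K * norm x"
    using assms(2)[of x] norm_ge_zero order_trans by blast
  ultimately show ?thesis
    by (cases "norm (adj T x) = 0") auto
qed

subsection \<open>Closed complex subspaces\<close>

definition csubspace :: "'a::chilbert set \<Rightarrow> bool" where
  "csubspace M \<longleftrightarrow> subspace M \<and> closed M \<and> (\<forall>x\<in>M. cJ x \<in> M)"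

lemma subspace_closure:
  fixes S :: "'a::real_normed_vector set"
  assumes S: "subspace S"
  shows "subspace (closure S)"
proof (rule subspaceI)
  show "0 \<in> closure S"
    using subspace_0[OF S] closure_subset by blast
  show "x + y \<in> closure S" if xy: "x \<in> closure S" "y \<in> closure S" for x y
  proof -
    obtain f g where f: "\<And>n. f n \<in> S" "f \<longlonglongrightarrow> x" and g: "\<And>n. g n \<in> S" "g \<longlonglongrightarrow> y"
      using xy unfolding closure_sequential by blast
    have "(\<lambda>n. f n + g n) \<longlonglongrightarrow> x + y"
      by (intro tendsto_add f g)
    thus ?thesis
      using f(1) g(1) S unfolding closure_sequential by (meson subspace_add)
  qed
  show "c *\<^sub>R x \<in> closure S" if "x \<in> closure S" for c x
  proof -
    obtain f where f: "\<And>n. f n \<in> S" "f \<longlonglongrightarrow> x"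
      using \<open>x \<in> closure S\<close> unfolding closure_sequential by blast
    have "(\<lambda>n. c *\<^sub>R f n) \<longlonglongrightarrow> c *\<^sub>R x"
      by (intro tendsto_scaleR tendsto_const f)
    thus ?thesis
      using f(1) S unfolding closure_sequential by (meson subspace_scale)
  qed
qed

lemma csubspace_closure_range:
  assumes "cbl T"
  shows "csubspace (closure (range T))"
  unfolding csubspace_def
proof (intro conjI ballI)
  show "subspace (closure (range T))"
    using linear_subspace_image[OF bounded_linear.linear[OF cbl_bounded_linear[OF assms]] subspace_UNIV]
    by (rule subspace_closure)
  show "closed (closure (range T))" by simp
  show "cJ x \<in> closure (range T)" if "x \<in> closure (range T)" for x
  proof -
    have "cJ ` closure (range T) \<subseteq> closure (cJ ` range T)"
      by (intro closure_bounded_linear_image_subset bounded_linear_cJ)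
    also have "cJ ` range T \<subseteq> range T"
      using assms by (auto simp flip: cbl_cJ)
    hence "closure (cJ ` range T) \<subseteq> closure (range T)"
      by (rule closure_mono)
    finally show ?thesis using that by auto
  qed
qed

lemma csubspace_scaleC: "csubspace M \<Longrightarrow> x \<in> M \<Longrightarrow> scaleC c x \<in> M"
  by (simp add: csubspace_def scaleC_def subspace_add subspace_scale)

lemma csubspace_add: "csubspace M \<Longrightarrow> x \<in> M \<Longrightarrow> y \<in> M \<Longrightarrow> x + y \<in> M"
  by (simp add: csubspace_def subspace_add)

lemma csubspace_diff: "csubspace M \<Longrightarrow> x \<in> M \<Longrightarrow> y \<in> M \<Longrightarrow> x - y \<in> M"
  by (simp add: csubspace_def subspace_diff)

lemma csubspace_eqI:
  assumes "csubspace M" "u \<in> M" "v \<in> M" "\<And>y. y \<in> M \<Longrightarrow> inner u y = inner v y"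
  shows "u = v"
proof -
  have "inner (u - v) (u - v) = 0"
    using assms by (simp add: csubspace_diff inner_diff_left)
  thus ?thesis by simp
qed

definition proj :: "'a::chilbert set \<Rightarrow> 'a \<Rightarrow> 'a" where
  "proj M x = (SOME u. u \<in> M \<and> (\<forall>y\<in>M. inner u y = inner x y))"

context
  fixes M :: "'a::chilbert set"
  assumes M: "csubspace M"
begin

lemma proj_in: "proj M x \<in> M"
  and inner_proj: "y \<in> M \<Longrightarrow> inner (proj M x) y = inner x y"
proof -
  have "\<exists>u\<in>M. \<forall>y\<in>M. inner u y = inner x y"
    using M by (intro riesz_subspace) (auto simp: csubspace_def bounded_linear_inner_right)
  hence "proj M x \<in> M \<and> (\<forall>y\<in>M. inner (proj M x) y = inner x y)"
    unfolding proj_def by - (rule someI_ex, auto)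
  thus "proj M x \<in> M" "y \<in> M \<Longrightarrow> inner (proj M x) y = inner x y"
    by auto
qed

lemma proj_eqI: "u \<in> M \<Longrightarrow> (\<And>y. y \<in> M \<Longrightarrow> inner u y = inner x y) \<Longrightarrow> proj M x = u"
  by (rule csubspace_eqI[OF M proj_in]) (simp_all add: inner_proj)

lemma proj_id: "x \<in> M \<Longrightarrow> proj M x = x"
  by (rule proj_eqI) auto

lemma norm_proj_le: "norm (proj M x) \<le> norm x"
proof -
  have "norm (proj M x) * norm (proj M x) \<le> norm x * norm (proj M x)"
    using inner_proj[OF proj_in, of x x] norm_cauchy_schwarz[of x "proj M x"]
    by (simp add: dot_square_norm power2_eq_square)
  thus ?thesis by (cases "norm (proj M x) = 0") auto
qed

lemma cbl_proj: "cbl (proj M)"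
  unfolding cbl_iff
proof (intro conjI allI)
  show "bounded_linear (proj M)"
  proof (rule bounded_linear_intro[where K=1])
    show "proj M (x + y) = proj M x + proj M y" for x y
      by (rule proj_eqI) (simp_all add: M csubspace_add proj_in inner_proj inner_add_left)
    show "proj M (r *\<^sub>R x) = r *\<^sub>R proj M x" for r x
      by (rule proj_eqI)
        (use M in \<open>simp_all add: proj_in inner_proj csubspace_def subspace_scale\<close>)
  qed (simp add: norm_proj_le)
  show "proj M (cJ x) = cJ (proj M x)" for x
    by (rule proj_eqI) (use M in \<open>simp_all add: proj_in inner_proj csubspace_def inner_cJ_left\<close>)
qed

text \<open>An operator of B(M) becomes a global one that vanishes on the orthogonal complement of
  M. Since \<open>F1\<close> factors through \<open>proj M\<close>, its adjoint has values in M and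
  so meets the description that defines \<open>sub_adj\<close>.\<close>

lemma
  assumes F: "sub_op M F"
  defines "F1 \<equiv> \<lambda>x. F (proj M x)"
  shows cbl_extension: "cbl F1"
    and extension_in: "F1 x \<in> M"
    and extension_eq: "x \<in> M \<Longrightarrow> F1 x = F x"
    and adj_extension_in: "adj F1 x \<in> M"
    and sub_adj_extension: "sub_adj M F x = adj F1 x"
proof -
  obtain K where K: "\<And>x. x \<in> M \<Longrightarrow> norm (F x) \<le> K * norm x"
    using F unfolding sub_op_def by blast
  have "norm (F1 x) \<le> \<bar>K\<bar> * norm x" for x
  proof -
    have "norm (F1 x) \<le> K * norm (proj M x)"
      unfolding F1_def by (rule K) (rule proj_in)
    also have "\<dots> \<le> \<bar>K\<bar> * norm x"
      by (intro mult_mono norm_proj_le) auto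
    finally show ?thesis .
  qed
  moreover have "F1 (x + y) = F1 x + F1 y" for x y
    using F by (simp add: F1_def sub_op_def cbl_add[OF cbl_proj] proj_in)
  moreover have "F1 (scaleC c x) = scaleC c (F1 x)" for c x
    using F by (simp add: F1_def sub_op_def cbl_scaleC[OF cbl_proj] proj_in)
  ultimately show cbl: "cbl F1"
    unfolding cbl_def by blast
  show "F1 x \<in> M"
    using F by (simp add: F1_def sub_op_def proj_in)
  show eq: "x \<in> M \<Longrightarrow> F1 x = F x" for x
    by (simp add: F1_def proj_id)
  have "proj M (adj F1 x) = adj F1 x"
  proof (rule inner_ext)
    fix y
    have "inner (proj M (adj F1 x)) y = inner (proj M (adj F1 x)) (proj M y)"
      by (metis inner_commute inner_proj proj_in)
    also have "\<dots> = inner x (F1 (proj M y))"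
      by (simp add: inner_proj proj_in inner_adj_left cbl)
    also have "F1 (proj M y) = F1 y"
      by (simp add: F1_def proj_id proj_in)
    finally show "inner (proj M (adj F1 x)) y = inner (adj F1 x) y"
      by (simp add: inner_adj_left cbl)
  qed
  thus A: "adj F1 x \<in> M"
    by (metis proj_in)
  show "sub_adj M F x = adj F1 x"
    unfolding sub_adj_def
  proof (rule the_equality, intro conjI ballI A)
    show "cinner (F y) x = cinner y (adj F1 x)" if "y \<in> M" for y
      using eq[OF that] by (simp add: cinner_eq_iff inner_adj_right cbl flip: cbl_cJ[OF cbl_adj[OF cbl]])
    show "u = adj F1 x" if u: "u \<in> M \<and> (\<forall>y\<in>M. cinner (F y) x = cinner y u)" for u
    proof (rule csubspace_eqI[OF M])
      show "inner u y = inner (adj F1 x) y" if "y \<in> M" for y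
        using u that eq[OF that] by (metis cinner_eq_iff inner_adj_right cbl inner_commute)
    qed (use u A in auto)
  qed
qed

text \<open>The vector \<open>F (proj M x)\<close> lies in M, so pairing it with \<open>x\<close> or
  with \<open>proj M x\<close> gives the same number. Scaling a nonzero \<open>proj M x\<close> to
  norm 1 then makes the supremum applicable, once its set is known to be bounded.\<close>

lemma num_radius_extension:
  assumes F: "sub_op M F" and w: "num_radius M F \<le> 1"
  shows "cmod (cinner (F (proj M x)) x) \<le> (norm x)\<^sup>2"
proof -
  define u where "u = proj M x"
  have u: "u \<in> M" by (simp add: u_def proj_in)
  obtain K where K: "\<And>x. x \<in> M \<Longrightarrow> norm (F x) \<le> K * norm x"
    using F unfolding sub_op_def by blast
  have bdd: "bdd_above (insert 0 {cmod (cinner (F x) x) |x. x \<in> M \<and> norm x = 1})"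
  proof -
    have "cmod (cinner (F y) y) \<le> 2 * K" if "y \<in> M" "norm y = 1" for y
    proof -
      have "cmod (cinner (F y) y) \<le> \<bar>inner (F y) y\<bar> + \<bar>inner (F y) (cJ y)\<bar>"
        unfolding cinner_def by (metis cmod_le complex.sel)
      also have "\<dots> \<le> norm (F y) * norm y + norm (F y) * norm (cJ y)"
        by (intro add_mono Cauchy_Schwarz_ineq2)
      finally show ?thesis
        using K[OF that(1)] that(2) by simp
    qed
    hence "bdd_above {cmod (cinner (F x) x) |x. x \<in> M \<and> norm x = 1}"
      by (intro bdd_aboveI[of _ "2 * K"]) auto
    thus ?thesis by simp
  qed
  have cin: "cinner (F u) x = cinner (F u) u"
  proof -
    have Fu: "F u \<in> M" using F u by (simp add: sub_op_def)
    have "inner (F u) y = inner (F u) (proj M y)" for y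
      using inner_proj[OF Fu, of y] by (simp add: inner_commute)
    from this[of x] this[of "cJ x"] show ?thesis
      by (simp add: cinner_def u_def cbl_cJ[OF cbl_proj])
  qed
  have "cmod (cinner (F u) u) \<le> (norm u)\<^sup>2"
  proof (cases "u = 0")
    case True
    thus ?thesis by (simp add: cinner_def zero_complex.code)
  next
    case False
    define r where "r = 1 / norm u"
    define v where "v = scaleC (of_real r) u"
    have v: "v \<in> M" "norm v = 1"
      using u False by (simp_all add: v_def csubspace_scaleC[OF M] r_def del: scaleC_of_real)
         (simp add: norm_scaleC norm_divide)
    have Fv: "F v = r *\<^sub>R F u"
      using F u unfolding sub_op_def v_def by (metis scaleC_of_real)
    have "cmod (cinner (F v) v) \<le> num_radius M F"
      unfolding num_radius_def using v by (intro cSup_upper bdd) auto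
    also have "cinner (F v) v = of_real (r * r) * cinner (F u) u"
      by (simp add: Fv) (simp add: v_def cinner_def complex_eq_iff cJ_scaleR)
    also have "cmod \<dots> = r * r * cmod (cinner (F u) u)"
      by (simp add: norm_mult)
    finally have "r * r * cmod (cinner (F u) u) \<le> 1" using w by simp
    thus ?thesis
      using False by (simp add: r_def field_simps power2_eq_square)
  qed
  also have "\<dots> \<le> (norm x)\<^sup>2"
    by (simp add: u_def norm_proj_le)
  finally show ?thesis
    using cin by (simp add: u_def)
qed

end

subsection \<open>Square roots and defect operators\<close>

text \<open>Y = (C + Y^2)/2 is equivalent to (1 - Y)^2 = 1 - C, so this fixed-point iteration from 0
  approximates Y = 1 - sqrt(1 - C). For C = \<open>adj P\<close> P, 1 - Y is the defect
  operator.\<close>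

fun sqrt_iter :: "('a::real_vector \<Rightarrow> 'a) \<Rightarrow> nat \<Rightarrow> 'a \<Rightarrow> 'a" where
  "sqrt_iter C 0 x = 0"
| "sqrt_iter C (Suc n) x = (1/2) *\<^sub>R (C x + sqrt_iter C n (sqrt_iter C n x))"

text \<open>The scalar iteration, which majorizes \<^const>\<open>sqrt_iter\<close> and its increments.\<close>

fun sqrt_bound :: "nat \<Rightarrow> real" where
  "sqrt_bound 0 = 0"
| "sqrt_bound (Suc n) = (1 + (sqrt_bound n)\<^sup>2) / 2"

definition sqrt_compl :: "('a::real_normed_vector \<Rightarrow> 'a) \<Rightarrow> 'a \<Rightarrow> 'a" where
  "sqrt_compl C x = lim (\<lambda>n. sqrt_iter C n x)"

lemma sqrt_bound_range: "0 \<le> sqrt_bound n \<and> sqrt_bound n \<le> 1"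
proof (induction n)
  case (Suc n)
  hence "(sqrt_bound n)\<^sup>2 \<le> 1" by (simp add: power_le_one)
  thus ?case by simp
qed simp

lemma sqrt_bound_mono: "sqrt_bound n \<le> sqrt_bound (Suc n)"
proof -
  have "0 \<le> (1 - sqrt_bound n)\<^sup>2" by simp
  thus ?thesis by (simp add: power2_eq_square algebra_simps)
qed

lemma sqrt_bound_convergent: "convergent sqrt_bound"
proof (rule Bseq_mono_convergent)
  show "Bseq sqrt_bound"
    by (rule BseqI'[of _ 1]) (use sqrt_bound_range in \<open>auto simp: abs_le_iff intro: order_trans[of _ 0]\<close>)
  show "\<forall>m. \<forall>n\<ge>m. sqrt_bound m \<le> sqrt_bound n"
    using lift_Suc_mono_le[of sqrt_bound] sqrt_bound_mono by blast
qed

lemma sqrt_iter_linear: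
  assumes "bounded_linear C"
  shows "bounded_linear (sqrt_iter C n)"
proof (induction n)
  case 0
  thus ?case by (simp add: bounded_linear_zero)
next
  case (Suc n)
  thus ?case
    unfolding sqrt_iter.simps
    by (intro bounded_linear_compose[OF bounded_linear_scaleR_right] bounded_linear_add assms
        bounded_linear_compose[OF Suc Suc])
qed

text \<open>Each iterate is a polynomial in C, hence passes through any X that takes C to
  \<open>C'\<close>. With X = \<open>cJ\<close> this gives complex linearity, with X an iterate
  commutativity, and with X = P a relation between two defect operators.\<close>

lemma sqrt_iter_intertwine:
  assumes "bounded_linear X" "\<And>x. X (C x) = C' (X x)"
  shows "X (sqrt_iter C n x) = sqrt_iter C' n (X x)"
proof (induction n arbitrary: x)
  case 0
  show ?case using assms(1) by (simp add: linear_simps)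
next
  case (Suc n)
  show ?case
    using assms(1) by (simp add: linear_simps assms(2) Suc)
qed

context
  fixes C :: "'a::chilbert \<Rightarrow> 'a"
  assumes C: "cbl C" and C_le: "\<And>x. norm (C x) \<le> norm x"
begin

lemma sqrt_iter_norm_le: "norm (sqrt_iter C n x) \<le> sqrt_bound n * norm x"
proof (induction n arbitrary: x)
  case (Suc n)
  have "norm (sqrt_iter C n (sqrt_iter C n x)) \<le> sqrt_bound n * norm (sqrt_iter C n x)"
    by (rule Suc)
  also have "\<dots> \<le> sqrt_bound n * (sqrt_bound n * norm x)"
    using sqrt_bound_range by (intro mult_left_mono Suc) auto
  finally have "norm (C x + sqrt_iter C n (sqrt_iter C n x)) \<le> norm x + sqrt_bound n * (sqrt_bound n * norm x)"
    using C_le[of x] by (intro norm_triangle_mono)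
  moreover have "norm (sqrt_iter C (Suc n) x) = norm (C x + sqrt_iter C n (sqrt_iter C n x)) / 2"
    by (simp only: sqrt_iter.simps norm_scaleR)
  ultimately show ?case
    by (simp add: power2_eq_square field_simps)
qed simp

lemma sqrt_iter_comm: "sqrt_iter C m (sqrt_iter C n x) = sqrt_iter C n (sqrt_iter C m x)"
proof (rule sqrt_iter_intertwine)
  show "bounded_linear (sqrt_iter C m)"
    by (rule sqrt_iter_linear) (rule cbl_bounded_linear[OF C])
  show "sqrt_iter C m (C x) = C (sqrt_iter C m x)" for x
    by (rule sqrt_iter_intertwine[symmetric]) (simp_all add: C cbl_bounded_linear)
qed

text \<open>Iterates commute, so after consecutive iterates A and B the next increment is (B - A)(B
  + A)/2. The scalar increment factors in the same way.\<close>

lemma sqrt_iter_diff_le: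
  "norm (sqrt_iter C (Suc n) x - sqrt_iter C n x) \<le> (sqrt_bound (Suc n) - sqrt_bound n) * norm x"
proof (induction n arbitrary: x)
  case 0
  show ?case using C_le[of x] by simp
next
  case (Suc n)
  define A B where "A = sqrt_iter C n" and "B = sqrt_iter C (Suc n)"
  define a b where "a = sqrt_bound n" and "b = sqrt_bound (Suc n)"
  have lin: "linear A" "linear B"
    unfolding A_def B_def by (intro bounded_linear.linear sqrt_iter_linear cbl_bounded_linear C)+
  have AB: "A (B x) = B (A x)"
    unfolding A_def B_def by (rule sqrt_iter_comm)
  have "sqrt_iter C (Suc (Suc n)) x - B x = (1/2) *\<^sub>R (C x + B (B x)) - (1/2) *\<^sub>R (C x + A (A x))"
    unfolding A_def B_def by (simp only: sqrt_iter.simps)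
  also have "\<dots> = (1/2) *\<^sub>R (B (B x + A x) - A (B x + A x))"
    using lin by (simp add: linear_add AB algebra_simps)
  finally have eq: "sqrt_iter C (Suc (Suc n)) x - B x = (1/2) *\<^sub>R (B (B x + A x) - A (B x + A x))" .
  have "norm (B (B x + A x) - A (B x + A x)) \<le> (b - a) * norm (B x + A x)"
    unfolding A_def B_def a_def b_def by (rule Suc)
  also have "\<dots> \<le> (b - a) * (b * norm x + a * norm x)"
    unfolding A_def B_def a_def b_def
    by (intro mult_left_mono norm_triangle_mono sqrt_iter_norm_le) (use sqrt_bound_mono in simp)
  also have "\<dots> = 2 * (((1 + b\<^sup>2) / 2 - (1 + a\<^sup>2) / 2) * norm x)"
    by (simp add: power2_eq_square algebra_simps)
  also have "(1 + b\<^sup>2) / 2 - (1 + a\<^sup>2) / 2 = sqrt_bound (Suc (Suc n)) - b"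
    unfolding a_def b_def by simp
  finally show ?case
    using eq unfolding B_def[symmetric] b_def[symmetric] by simp
qed

lemma sqrt_iter_LIMSEQ: "(\<lambda>n. sqrt_iter C n x) \<longlonglongrightarrow> sqrt_compl C x"
proof -
  have "summable (\<lambda>n. (sqrt_bound (Suc n) - sqrt_bound n) * norm x)"
    using sqrt_bound_convergent
    by (intro summable_mult2) (metis convergent_def telescope_summable)
  hence "summable (\<lambda>n. sqrt_iter C (Suc n) x - sqrt_iter C n x)"
    by (rule summable_comparison_test'[where N=0]) (rule sqrt_iter_diff_le)
  hence "convergent (\<lambda>n. \<Sum>i<n. sqrt_iter C (Suc i) x - sqrt_iter C i x)"
    by (simp add: summable_iff_convergent)
  hence "convergent (\<lambda>n. sqrt_iter C n x)"
    by (simp only: sum_lessThan_telescope[of "\<lambda>n. sqrt_iter C n x"] sqrt_iter.simps(1) diff_0_right)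
  thus ?thesis
    unfolding sqrt_compl_def by (simp add: convergent_LIMSEQ_iff)
qed

lemma norm_sqrt_compl_le: "norm (sqrt_compl C x) \<le> norm x"
proof (rule Lim_bounded)
  show "(\<lambda>n. norm (sqrt_iter C n x)) \<longlonglongrightarrow> norm (sqrt_compl C x)"
    by (intro tendsto_norm sqrt_iter_LIMSEQ)
  show "\<forall>n\<ge>0. norm (sqrt_iter C n x) \<le> norm x"
    using sqrt_iter_norm_le[of _ x] sqrt_bound_range
    by (meson mult_left_le_one_le norm_ge_zero order_trans)
qed

lemma cbl_sqrt_compl: "cbl (sqrt_compl C)"
  unfolding cbl_iff
proof (intro conjI allI)
  have lin: "linear (sqrt_iter C n)" for n
    by (intro bounded_linear.linear sqrt_iter_linear cbl_bounded_linear C)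
  show "bounded_linear (sqrt_compl C)"
  proof (rule bounded_linear_intro[where K=1])
    show "sqrt_compl C (x + y) = sqrt_compl C x + sqrt_compl C y" for x y
      using tendsto_add[OF sqrt_iter_LIMSEQ[of x] sqrt_iter_LIMSEQ[of y]] sqrt_iter_LIMSEQ[of "x + y"]
      by (simp add: linear_add[OF lin] LIMSEQ_unique)
    show "sqrt_compl C (r *\<^sub>R x) = r *\<^sub>R sqrt_compl C x" for r x
      using tendsto_scaleR[OF tendsto_const[of r] sqrt_iter_LIMSEQ[of x]] sqrt_iter_LIMSEQ[of "r *\<^sub>R x"]
      by (simp add: linear_scale[OF lin] LIMSEQ_unique)
  qed (simp add: norm_sqrt_compl_le)
  show "sqrt_compl C (cJ x) = cJ (sqrt_compl C x)" for x
  proof -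
    have "cJ (sqrt_iter C n x) = sqrt_iter C n (cJ x)" for n
      by (rule sqrt_iter_intertwine[OF bounded_linear_cJ]) (simp add: cbl_cJ[OF C])
    thus ?thesis
      using bounded_linear.tendsto[OF bounded_linear_cJ sqrt_iter_LIMSEQ[of x]] sqrt_iter_LIMSEQ[of "cJ x"]
      by (simp add: LIMSEQ_unique)
  qed
qed

lemma sqrt_compl_sym:
  assumes C_sym: "\<And>x y. inner (C x) y = inner x (C y)"
  shows "inner (sqrt_compl C x) y = inner x (sqrt_compl C y)"
proof -
  have it: "inner (sqrt_iter C n x) y = inner x (sqrt_iter C n y)" for n x y
    by (induction n arbitrary: x y) (simp_all add: inner_add_left inner_add_right C_sym)
  have "(\<lambda>n. inner (sqrt_iter C n x) y) \<longlonglongrightarrow> inner (sqrt_compl C x) y"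
    "(\<lambda>n. inner x (sqrt_iter C n y)) \<longlonglongrightarrow> inner x (sqrt_compl C y)"
    by (intro tendsto_inner tendsto_const sqrt_iter_LIMSEQ)+
  thus ?thesis by (simp add: it LIMSEQ_unique)
qed

lemma sqrt_compl_eq: "sqrt_compl C x = (1/2) *\<^sub>R (C x + sqrt_compl C (sqrt_compl C x))"
proof -
  define Y where "Y = sqrt_compl C"
  have lin: "linear (sqrt_iter C n)" for n
    by (intro bounded_linear.linear sqrt_iter_linear cbl_bounded_linear C)
  \<comment> \<open>Strong convergence need not pass to a composite. Here the first summand vanishes
    because the iterates are contractions uniformly in \<open>n\<close>.\<close>
  have "(\<lambda>n. sqrt_iter C n (sqrt_iter C n x - Y x) + sqrt_iter C n (Y x)) \<longlonglongrightarrow> 0 + Y (Y x)"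
  proof (intro tendsto_add)
    have "(\<lambda>n. norm (sqrt_iter C n x - Y x)) \<longlonglongrightarrow> norm (Y x - Y x)"
      unfolding Y_def by (intro tendsto_norm tendsto_diff sqrt_iter_LIMSEQ tendsto_const)
    hence lim: "(\<lambda>n. norm (sqrt_iter C n x - Y x)) \<longlonglongrightarrow> 0" by simp
    have le: "norm (sqrt_iter C n z) \<le> norm z" for n z
      using sqrt_iter_norm_le[of n z] sqrt_bound_range[of n]
      by (meson mult_left_le_one_le norm_ge_zero order_trans)
    show "(\<lambda>n. sqrt_iter C n (sqrt_iter C n x - Y x)) \<longlonglongrightarrow> 0"
      by (rule tendsto_0_le[OF lim, where K=1]) (simp add: le)
    show "(\<lambda>n. sqrt_iter C n (Y x)) \<longlonglongrightarrow> Y (Y x)"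
      unfolding Y_def by (rule sqrt_iter_LIMSEQ)
  qed
  hence "(\<lambda>n. sqrt_iter C n (sqrt_iter C n x)) \<longlonglongrightarrow> Y (Y x)"
    using lin by (simp add: linear_diff)
  hence "(\<lambda>n. sqrt_iter C (Suc n) x) \<longlonglongrightarrow> (1/2) *\<^sub>R (C x + Y (Y x))"
    unfolding sqrt_iter.simps by (intro tendsto_intros)
  moreover have "(\<lambda>n. sqrt_iter C (Suc n) x) \<longlonglongrightarrow> Y x"
    unfolding Y_def by (intro LIMSEQ_Suc sqrt_iter_LIMSEQ)
  ultimately show ?thesis
    unfolding Y_def by (rule LIMSEQ_unique[rotated])
qed

lemma sqrt_compl_root:
  "x - sqrt_compl C x - sqrt_compl C (x - sqrt_compl C x) = x - C x"
proof -
  have "2 *\<^sub>R sqrt_compl C x = C x + sqrt_compl C (sqrt_compl C x)"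
    using arg_cong[OF sqrt_compl_eq[of x], of "\<lambda>v. 2 *\<^sub>R v"] by (simp only: scaleR_scaleR) simp
  thus ?thesis
    by (simp add: cbl_diff[OF cbl_sqrt_compl] scaleR_2 algebra_simps)
qed

end

lemma sqrt_compl_intertwine:
  fixes C C' X :: "'a::chilbert \<Rightarrow> 'a"
  assumes C: "cbl C" "\<And>x. norm (C x) \<le> norm x"
    and C': "cbl C'" "\<And>x. norm (C' x) \<le> norm x"
    and X: "bounded_linear X" "\<And>x. X (C x) = C' (X x)"
  shows "X (sqrt_compl C x) = sqrt_compl C' (X x)"
proof -
  have "(\<lambda>n. X (sqrt_iter C n x)) \<longlonglongrightarrow> X (sqrt_compl C x)"
    by (intro bounded_linear.tendsto[OF X(1)] sqrt_iter_LIMSEQ C)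
  moreover have "X (sqrt_iter C n x) = sqrt_iter C' n (X x)" for n
    using X by (rule sqrt_iter_intertwine)
  hence "(\<lambda>n. X (sqrt_iter C n x)) \<longlonglongrightarrow> sqrt_compl C' (X x)"
    using sqrt_iter_LIMSEQ[OF C', of "X x"] by simp
  ultimately show ?thesis by (rule LIMSEQ_unique)
qed

text \<open>For uniqueness, a positive root E of 1 - C commutes with C, hence with B. Then y = Bx -
  Ex satisfies <By,y> + <Ey,y> = <(B^2 - E^2)x, y> = 0, so both terms vanish. Positivity gives By =
  Ey = 0, and |y|^2 = <x, By - Ey> = 0.\<close>

lemma op_sqrt_eq:
  fixes C :: "'a::chilbert \<Rightarrow> 'a"
  assumes C: "cbl C" "\<And>x. norm (C x) \<le> norm x" "\<And>x y. inner (C x) y = inner x (C y)"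
  shows "op_sqrt (\<lambda>x. x - C x) = (\<lambda>x. x - sqrt_compl C x)"
  unfolding op_sqrt_def
proof (rule the_equality)
  define Y where "Y = sqrt_compl C"
  define B where "B = (\<lambda>x. x - Y x)"
  have Y: "cbl Y" "\<And>x. norm (Y x) \<le> norm x" "\<And>x y. inner (Y x) y = inner x (Y y)"
    "\<And>x. Y x = (1/2) *\<^sub>R (C x + Y (Y x))"
    unfolding Y_def
    by (fact cbl_sqrt_compl[OF C(1,2)] norm_sqrt_compl_le[OF C(1,2)]
        sqrt_compl_sym[OF C] sqrt_compl_eq[OF C(1,2)])+
  have B: "cbl B" "\<And>x y. inner (B x) y = inner x (B y)"
    unfolding B_def by (simp_all add: cbl_minus cbl_id Y(1,3) inner_diff_left inner_diff_right)
  have BB: "B (B x) = x - C x" for x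
    unfolding B_def Y_def by (rule sqrt_compl_root[OF C(1,2)])
  have B_pos: "0 \<le> inner (B x) x" for x
  proof -
    have "inner (Y x) x \<le> norm (Y x) * norm x" by (rule norm_cauchy_schwarz)
    also have "\<dots> \<le> norm x * norm x" by (intro mult_right_mono Y) auto
    finally show ?thesis
      by (simp add: B_def inner_diff_left dot_square_norm power2_eq_square)
  qed
  have BJ: "inner (B x) (cJ x) = 0" for x
  proof -
    have "inner (B x) (cJ x) = inner (cJ (B x)) x"
      using B(2)[of x "cJ x"] by (simp add: cbl_cJ[OF B(1)] inner_commute)
    thus ?thesis by (simp add: inner_cJ_left)
  qed
  show "cbl (\<lambda>x. x - sqrt_compl C x) \<and>
    (\<forall>x. Im (cinner (x - sqrt_compl C x) x) = 0 \<and> 0 \<le> Re (cinner (x - sqrt_compl C x) x)) \<and>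
    (\<forall>x. x - sqrt_compl C x - sqrt_compl C (x - sqrt_compl C x) = x - C x)"
    using B(1) BB B_pos BJ unfolding B_def Y_def by (simp add: cinner_def)
  show "E = (\<lambda>x. x - sqrt_compl C x)"
    if E: "cbl E \<and> (\<forall>x. Im (cinner (E x) x) = 0 \<and> 0 \<le> Re (cinner (E x) x)) \<and>
      (\<forall>x. E (E x) = x - C x)" for E
  proof -
    have E1: "cbl E" and E2: "\<And>x. inner (E x) (cJ x) = 0" and E_pos: "\<And>x. 0 \<le> inner (E x) x"
      and EE: "\<And>x. E (E x) = x - C x"
      using E by (simp_all add: cinner_def)
    \<comment> \<open>Only the quadratic form of E is known to be real; polarisation at x - iy turns
      this into symmetry.\<close>
    have E_sym: "inner (E x) y = inner x (E y)" for x y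
    proof -
      have "inner (E (x - cJ y)) (cJ (x - cJ y)) = 0" by (rule E2)
      hence "inner (E x) y + inner (cJ (E y)) (cJ x) * -1 = 0"
        using E2[of x] E2[of "cJ y"]
        by (simp add: cbl_diff[OF E1] cJ_diff inner_diff_left inner_diff_right inner_add_right cJ_cJ cbl_cJ[OF E1])
      thus ?thesis by (simp add: cJ_inner inner_commute)
    qed
    have "E (C x) = C (E x)" for x
      using EE[of "E x"] arg_cong[OF EE[of x], of E] by (simp add: cbl_diff[OF E1])
    hence EB: "E (B x) = B (E x)" for x
      unfolding B_def Y_def using sqrt_compl_intertwine[OF C(1,2) C(1,2) cbl_bounded_linear[OF E1]]
      by (simp add: cbl_diff[OF E1])
    \<comment> \<open>Positivity at y - t(Ay) is a quadratic inequality in t without constant term,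
      which forces its linear coefficient to vanish.\<close>
    have null: "A y = 0" if A: "cbl A" "\<And>x y. inner (A x) y = inner x (A y)" "\<And>x. 0 \<le> inner (A x) x"
      and 0: "inner (A y) y = 0" for A :: "'a \<Rightarrow> 'a" and y
    proof -
      define K where "K = inner (A (A y)) (A y) + 1"
      have K: "K > 0" using A(3)[of "A y"] by (simp add: K_def add_nonneg_pos)
      define n where "n = inner (A y) (A y)"
      have q: "0 \<le> - 2 * t * n + t\<^sup>2 * K" for t
      proof -
        have "0 \<le> inner (A (y - t *\<^sub>R A y)) (y - t *\<^sub>R A y)" by (rule A(3))
        also have "\<dots> = - 2 * t * n + t\<^sup>2 * (K - 1)"
          using 0 by (simp add: cbl_diff[OF A(1)] cbl_scaleR[OF A(1)] inner_diff_left inner_diff_right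
              n_def K_def A(2)[of "A y" y] power2_eq_square algebra_simps)
        also have "\<dots> \<le> - 2 * t * n + t\<^sup>2 * K"
          by (intro add_left_mono mult_left_mono) auto
        finally show ?thesis .
      qed
      have "0 \<le> - 2 * (n / K) * n + (n / K)\<^sup>2 * K" by (rule q)
      also have "\<dots> = - (n\<^sup>2 / K)" using K by (simp add: power2_eq_square field_simps)
      finally have "n\<^sup>2 / K \<le> 0" by simp
      hence "n = 0" using K by (simp add: divide_le_0_iff)
      thus ?thesis by (simp add: n_def)
    qed
    have "E x = B x" for x
    proof -
      define y where "y = B x - E x"
      have By: "B y = B (B x) - B (E x)" and Ey: "E y = B (E x) - E (E x)"
        by (simp_all add: y_def cbl_diff[OF B(1)] cbl_diff[OF E1] EB)
      have "inner (B y) y + inner (E y) y = 0"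
        unfolding inner_add_left[symmetric] By Ey by (simp add: BB EE)
      hence "inner (B y) y = 0" "inner (E y) y = 0"
        using B_pos[of y] E_pos[of y] by linarith+
      hence "B y = 0" "E y = 0"
        using null[OF B B_pos] null[OF E1 E_sym E_pos] by blast+
      have "inner y y = inner x (B y) - inner x (E y)"
        by (subst (1) y_def) (simp add: inner_diff_left B(2) E_sym)
      hence "y = 0" using \<open>B y = 0\<close> \<open>E y = 0\<close> by simp
      thus ?thesis by (simp add: y_def)
    qed
    thus ?thesis by (auto simp: B_def Y_def)
  qed
qed

section \<open>Defect operators of a contraction\<close>

lemma contraction_adj: "contraction P \<Longrightarrow> contraction (adj P)"
  using norm_adj_le[of P 1] by (simp add: contraction_def cbl_adj)

context
  fixes P :: "'a::chilbert \<Rightarrow> 'a"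
  assumes P: "contraction P"
begin

lemma contraction_gram:
  "cbl (\<lambda>x. adj P (P x))" "norm (adj P (P x)) \<le> norm x"
  "inner (adj P (P x)) y = inner x (adj P (P y))"
proof -
  have cP: "cbl P" and le: "\<And>x. norm (P x) \<le> norm x" "\<And>x. norm (adj P x) \<le> norm x"
    using P contraction_adj[OF P] by (auto simp: contraction_def)
  show "cbl (\<lambda>x. adj P (P x))"
    by (rule cbl_compose[OF cbl_adj[OF cP] cP])
  show "norm (adj P (P x)) \<le> norm x"
    using le order_trans by blast
  show "inner (adj P (P x)) y = inner x (adj P (P y))"
    by (simp add: inner_adj_left[OF cP] inner_adj_right[OF cP])
qed

lemma defect_eq: "defect P = (\<lambda>x. x - sqrt_compl (\<lambda>x. adj P (P x)) x)"
  unfolding defect_def by (intro op_sqrt_eq contraction_gram)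

lemma cbl_defect: "cbl (defect P)"
  unfolding defect_eq by (intro cbl_minus cbl_id cbl_sqrt_compl contraction_gram)

lemma defect_sym: "inner (defect P x) y = inner x (defect P y)"
  unfolding defect_eq inner_diff_left inner_diff_right
  by (simp add: sqrt_compl_sym[OF contraction_gram])

lemma defect_defect: "defect P (defect P x) = x - adj P (P x)"
  unfolding defect_eq by (rule sqrt_compl_root) (rule contraction_gram)+

lemma csubspace_defect_space: "csubspace (defect_space P)"
  unfolding defect_space_def by (intro csubspace_closure_range cbl_defect)

lemma defect_in: "defect P x \<in> defect_space P"
  unfolding defect_space_def by (rule subsetD[OF closure_subset]) simp

end

lemma defect_intertwine:
  assumes P: "contraction P"
  shows "P (defect P x) = defect (adj P) (P x)"
proof -
  have cP: "cbl P" using P by (simp add: contraction_def)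
  have "P (sqrt_compl (\<lambda>x. adj P (P x)) x) = sqrt_compl (\<lambda>x. adj (adj P) (adj P x)) (P x)"
    by (rule sqrt_compl_intertwine[OF contraction_gram(1,2)[OF P]
          contraction_gram(1,2)[OF contraction_adj[OF P]] cbl_bounded_linear[OF cP]])
      (simp add: adj_adj cP)
  thus ?thesis
    by (simp add: defect_eq[OF P] defect_eq[OF contraction_adj[OF P]] cbl_diff[OF cP])
qed

text \<open>Follows by continuity from \<open>defect_intertwine\<close>. It makes the constant
  coefficient -P of the characteristic function a map between the two defect spaces.\<close>

lemma contraction_maps_defect_space:
  assumes P: "contraction P" and x: "x \<in> defect_space P"
  shows "P x \<in> defect_space (adj P)"
proof -
  have "P ` closure (range (defect P)) \<subseteq> closure (P ` range (defect P))"
    using P by (intro closure_bounded_linear_image_subset cbl_bounded_linear) (simp add: contraction_def)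
  also have "\<dots> \<subseteq> closure (range (defect (adj P)))"
    by (intro closure_mono) (auto simp: defect_intertwine[OF P])
  finally show ?thesis using x by (auto simp: defect_space_def)
qed

subsection \<open>The commutant lifting operator\<close>

text \<open>\<open>\<theta> n\<close> are the Taylor coefficients of the characteristic function, so that \<open>\<theta>_0\<close> and \<open>\<theta>_Suc\<close>
  compare coefficients in the intertwining relation. \<open>Q\<close>, \<open>F'\<close>, \<open>G'\<close> are the adjoints of \<open>P\<close>, \<open>F\<close>, \<open>G\<close>;
  \<open>D\<close>, \<open>E\<close> are the defect operators of \<open>P\<close>, \<open>Q\<close>, and \<open>M\<close>, \<open>N\<close> their defect spaces.\<close>

locale pure_intertwining =
  fixes P Q D E F F' G G' :: "'a::chilbert \<Rightarrow> 'a" and M N :: "'a set"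
    and \<theta> :: "nat \<Rightarrow> 'a \<Rightarrow> 'a"
  assumes cbl: "cbl P" "cbl Q" "cbl D" "cbl E" "cbl F" "cbl F'" "cbl G" "cbl G'"
    and PQ: "inner (P x) y = inner x (Q y)"
    and D_sym: "inner (D x) y = inner x (D y)"
    and E_sym: "inner (E x) y = inner x (E y)"
    and FF': "inner (F x) y = inner x (F' y)"
    and GG': "inner (G x) y = inner x (G' y)"
    and DD: "D (D x) = x - Q (P x)"
    and EE: "E (E x) = x - P (Q x)"
    and PD: "P (D x) = E (P x)"
    and QE: "Q (E x) = D (Q x)"
    and pure: "(\<lambda>n. (Q ^^ n) x) \<longlonglongrightarrow> 0"
    and M: "csubspace M" and D_in: "D x \<in> M" and F_in: "F x \<in> M" and F'_in: "F' x \<in> M"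
    and N: "csubspace N" and E_in: "E x \<in> N" and G_in: "G x \<in> N" and G'_in: "G' x \<in> N"
    and Q_in: "y \<in> N \<Longrightarrow> Q y \<in> M"
    and \<theta>_eq: "\<theta> 0 x = - P x" "\<theta> (Suc k) x = E ((Q ^^ k) (D x))"
    and \<theta>_0: "x \<in> M \<Longrightarrow> \<theta> 0 (F x) = G' (\<theta> 0 x)"
    and \<theta>_Suc: "x \<in> M \<Longrightarrow> \<theta> (Suc n) (F x) + \<theta> n (F' x) = G' (\<theta> (Suc n) x) + G (\<theta> n x)"
begin

lemmas add = cbl(1-8)[THEN cbl_add] and diff = cbl(1-8)[THEN cbl_diff]
  and zero = cbl(1-8)[THEN cbl_zero] and neg = cbl(1-8)[THEN cbl_neg]
  and sum = cbl(1-8)[THEN cbl_sum] and tendsto = cbl(1-8)[THEN cbl_tendsto]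

lemma QP: "inner (Q x) y = inner x (P y)"
  by (metis PQ inner_commute)

lemma PQ_pow: "inner ((P ^^ n) x) y = inner x ((Q ^^ n) y)"
  by (induction n arbitrary: x y) (simp_all add: PQ funpow_swap1[of Q])

lemma QP_pow: "inner ((Q ^^ n) x) y = inner x ((P ^^ n) y)"
  by (metis PQ_pow inner_commute)

lemma G'G: "inner (G' x) y = inner x (G y)"
  by (metis GG' inner_commute)

lemma F'F: "inner (F' x) y = inner x (F y)"
  by (metis FF' inner_commute)

lemma cbl_pow: "cbl (P ^^ n)" "cbl (Q ^^ n)"
  by (simp_all add: cbl cbl_funpow)

lemmas pow_add = cbl_pow[THEN cbl_add] and pow_diff = cbl_pow[THEN cbl_diff]
  and pow_zero = cbl_pow[THEN cbl_zero]

text \<open>The adjoints of the \<open>\<theta> n\<close>, which are also the Taylor coefficients of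
  the characteristic function of Q.\<close>

definition \<theta>' where
  "\<theta>' n x = (case n of 0 \<Rightarrow> - Q x | Suc k \<Rightarrow> D ((P ^^ k) (E x)))"

lemma theta_adjoint: "inner (\<theta> n x) y = inner x (\<theta>' n y)"
  by (cases n) (simp_all add: \<theta>_eq \<theta>'_def PQ E_sym D_sym QP_pow)

lemma theta'_in: "y \<in> N \<Longrightarrow> \<theta>' n y \<in> M"
  using M by (cases n) (simp_all add: \<theta>'_def D_in Q_in csubspace_def subspace_neg)

text \<open>The relation for \<open>\<theta> 0\<close> is known on M only. Both sides here lie in M,
  so pairing with vectors of M is enough; the same device serves \<open>theta'_Suc\<close>.\<close>

lemma theta'_0: assumes "y \<in> N" shows "F' (Q y) = Q (G y)"
proof (rule csubspace_eqI[OF M F'_in Q_in[OF G_in]])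
  fix x assume x: "x \<in> M"
  have "P (F x) = G' (P x)"
    using \<theta>_0[OF x] by (simp add: \<theta>_eq neg)
  thus "inner (F' (Q y)) x = inner (Q (G y)) x"
    by (simp add: F'F QP GG')
qed

lemma theta'_Suc:
  assumes y: "y \<in> N"
  shows "F' (\<theta>' (Suc n) y) + F (\<theta>' n y) = \<theta>' (Suc n) (G y) + \<theta>' n (G' y)"
proof (rule csubspace_eqI[OF M])
  show "F' (\<theta>' (Suc n) y) + F (\<theta>' n y) \<in> M" "\<theta>' (Suc n) (G y) + \<theta>' n (G' y) \<in> M"
    by (intro csubspace_add[OF M] F_in F'_in theta'_in G_in G'_in)+
  fix x assume x: "x \<in> M"
  have adj: "inner (\<theta>' k z) w = inner z (\<theta> k w)" for k z w
    by (metis theta_adjoint inner_commute)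
  have "inner (F' (\<theta>' (Suc n) y) + F (\<theta>' n y)) x = inner y (\<theta> (Suc n) (F x) + \<theta> n (F' x))"
    by (simp add: inner_add_left inner_add_right F'F FF' adj)
  also have "\<dots> = inner (\<theta>' (Suc n) (G y) + \<theta>' n (G' y)) x"
    unfolding \<theta>_Suc[OF x] by (simp add: inner_add_left inner_add_right G'G GG' adj)
  finally show "inner (F' (\<theta>' (Suc n) y) + F (\<theta>' n y)) x = inner (\<theta>' (Suc n) (G y) + \<theta>' n (G' y)) x" .
qed

section \<open>The model embedding and its adjoint as contractions\<close>

lemma norm_E: "(norm (E x))\<^sup>2 = (norm x)\<^sup>2 - (norm (Q x))\<^sup>2"
proof -
  have "inner (E x) (E x) = inner x x - inner x (P (Q x))"
    by (simp add: E_sym EE inner_diff_right)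
  thus ?thesis by (simp add: power2_norm_eq_inner QP)
qed

lemma norm_Q_pow_le: "norm (Q x) \<le> norm x" "norm (P x) \<le> norm x"
  "norm ((Q ^^ n) x) \<le> norm x" "norm ((P ^^ n) x) \<le> norm x"
proof -
  have D2: "(norm (D x))\<^sup>2 = (norm x)\<^sup>2 - (norm (P x))\<^sup>2" for x
    by (simp add: power2_norm_eq_inner D_sym DD inner_diff_right PQ)
  have Q: "norm (Q x) \<le> norm x" for x
    by (rule power2_le_imp_le) (use norm_E[of x] zero_le_power2[of "norm (E x)"] in linarith, simp)
  have P: "norm (P x) \<le> norm x" for x
    by (rule power2_le_imp_le) (use D2[of x] zero_le_power2[of "norm (D x)"] in linarith, simp)
  show "norm (Q x) \<le> norm x" "norm (P x) \<le> norm x" by (rule Q P)+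
  show "norm ((Q ^^ n) x) \<le> norm x" "norm ((P ^^ n) x) \<le> norm x"
    by (induction n) (auto intro: order_trans[OF Q] order_trans[OF P])
qed

text \<open>By \<open>norm_E\<close> the sum telescopes. At a = 0 this is contractivity of the
  embedding; a general \<open>a\<close> leaves a bound that tends to 0 by purity.\<close>

lemma norm_E_sum: "(\<Sum>m\<in>{a..<b}. (norm (E ((Q ^^ m) x)))\<^sup>2) \<le> (norm ((Q ^^ a) x))\<^sup>2"
proof (cases "a \<le> b")
  case True
  hence "(\<Sum>m\<in>{a..<b}. (norm (E ((Q ^^ m) x)))\<^sup>2) = (norm ((Q ^^ a) x))\<^sup>2 - (norm ((Q ^^ b) x))\<^sup>2"
    by (induction b rule: dec_induct) (simp_all add: norm_E)
  thus ?thesis by simp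
qed simp

text \<open>Duality with \<open>norm_E_sum\<close>: pair the sum \<open>v\<close> with itself, move
  the operators to the other side and apply Cauchy-Schwarz.\<close>

lemma synthesis_bound:
  "(norm (\<Sum>m\<in>{a..<b}. (P ^^ m) (E (g m))))\<^sup>2 \<le> (\<Sum>m\<in>{a..<b}. (norm (g m))\<^sup>2)"
proof -
  define v where "v = (\<Sum>m\<in>{a..<b}. (P ^^ m) (E (g m)))"
  have "(norm v)\<^sup>2 = inner v v" by (rule power2_norm_eq_inner)
  also have "\<dots> = (\<Sum>m\<in>{a..<b}. inner (g m) (E ((Q ^^ m) v)))"
    by (subst (1) v_def) (simp add: inner_sum_left PQ_pow E_sym)
  also have "\<dots> \<le> (\<Sum>m\<in>{a..<b}. norm (g m) * norm (E ((Q ^^ m) v)))"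
    by (intro sum_mono norm_cauchy_schwarz)
  finally have "((norm v)\<^sup>2)\<^sup>2 \<le> (\<Sum>m\<in>{a..<b}. norm (g m) * norm (E ((Q ^^ m) v)))\<^sup>2"
    by (intro power_mono) auto
  also have "\<dots> \<le> (\<Sum>m\<in>{a..<b}. (norm (g m))\<^sup>2) * (\<Sum>m\<in>{a..<b}. (norm (E ((Q ^^ m) v)))\<^sup>2)"
    by (rule Cauchy_Schwarz_ineq_sum)
  also have "\<dots> \<le> (\<Sum>m\<in>{a..<b}. (norm (g m))\<^sup>2) * (norm v)\<^sup>2"
    by (intro mult_left_mono sum_nonneg order_trans[OF norm_E_sum] power_mono norm_Q_pow_le) auto
  finally have *: "((norm v)\<^sup>2)\<^sup>2 \<le> (\<Sum>m\<in>{a..<b}. (norm (g m))\<^sup>2) * (norm v)\<^sup>2" .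
  have "(norm v)\<^sup>2 \<le> (\<Sum>m\<in>{a..<b}. (norm (g m))\<^sup>2)"
  proof (cases "v = 0")
    case False
    have "(norm v)\<^sup>2 * (norm v)\<^sup>2 \<le> (\<Sum>m\<in>{a..<b}. (norm (g m))\<^sup>2) * (norm v)\<^sup>2"
      using * by (simp only: power2_eq_square[of "(norm v)\<^sup>2"])
    thus ?thesis
      by (rule mult_right_le_imp_le) (use False in simp)
  qed (simp add: sum_nonneg)
  thus ?thesis by (simp add: v_def)
qed

text \<open>The adjoint of multiplication by G' + G z takes (g_n) to (G g_n + G' g_(n+1)). On the
  model sequence g_n = E (Q^n h) its n-th coefficient is \<open>f ((Q ^^ n) h)\<close>.\<close>

definition f where "f h = G (E h) + G' (E (Q h))"

definition Tn where "Tn n h = (\<Sum>m<n. (P ^^ m) (E (f ((Q ^^ m) h))))"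

definition T where "T h = lim (\<lambda>n. Tn n h)"

lemma cbl_f: "cbl f"
  unfolding f_def
  by (rule cbl_plus[OF cbl_compose[OF cbl(7) cbl(4)] cbl_compose[OF cbl(8) cbl_compose[OF cbl(4) cbl(2)]]])

lemma cbl_Tn: "cbl (Tn n)"
proof -
  have "cbl (\<lambda>h. (P ^^ m) (E (f ((Q ^^ m) h))))" for m
    by (rule cbl_compose[OF cbl_pow(1) cbl_compose[OF cbl(4) cbl_compose[OF cbl_f cbl_pow(2)]]])
  thus ?thesis unfolding Tn_def by (intro cbl_sum_fun) auto
qed

text \<open>\<open>synthesis_bound\<close> leaves the squared norms of
  \<open>f ((Q ^^ m) h)\<close>, and these cost two sums as in \<open>norm_E_sum\<close>, for
  \<open>h\<close> and for \<open>Q h\<close>. One estimate serves both convergence (large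
  \<open>a\<close>, by purity) and boundedness (\<open>a\<close> = 0).\<close>

lemma ex_tail_bound: "\<exists>K\<ge>0. \<forall>a b h. norm (\<Sum>m\<in>{a..<b}. (P ^^ m) (E (f ((Q ^^ m) h)))) \<le> K * norm ((Q ^^ a) h)"
proof -
  obtain K1 K2 where K: "K1 > 0" "\<And>x. norm (G x) \<le> K1 * norm x" "K2 > 0" "\<And>x. norm (G' x) \<le> K2 * norm x"
    using cbl_pos_bound[OF cbl(7)] cbl_pos_bound[OF cbl(8)] by auto
  define K where "K = K1 + K2"
  have f_le: "(norm (f x))\<^sup>2 \<le> K\<^sup>2 * (2 * (norm (E x))\<^sup>2 + 2 * (norm (E (Q x)))\<^sup>2)" for x
  proof -
    have "norm (f x) \<le> K1 * norm (E x) + K2 * norm (E (Q x))"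
      unfolding f_def by (intro norm_triangle_mono K)
    also have "\<dots> \<le> K * norm (E x) + K * norm (E (Q x))"
      using K by (intro add_mono mult_right_mono) (auto simp: K_def)
    finally have "(norm (f x))\<^sup>2 \<le> (K * (norm (E x) + norm (E (Q x))))\<^sup>2"
      by (intro power_mono) (auto simp: algebra_simps)
    also have "\<dots> = K\<^sup>2 * (norm (E x) + norm (E (Q x)))\<^sup>2"
      by (simp add: power_mult_distrib)
    also have "\<dots> \<le> K\<^sup>2 * (2 * (norm (E x))\<^sup>2 + 2 * (norm (E (Q x)))\<^sup>2)"
    proof (rule mult_left_mono)
      have "0 \<le> (norm (E x) - norm (E (Q x)))\<^sup>2" by simp
      thus "(norm (E x) + norm (E (Q x)))\<^sup>2 \<le> 2 * (norm (E x))\<^sup>2 + 2 * (norm (E (Q x)))\<^sup>2"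
        by (simp add: power2_eq_square algebra_simps)
    qed simp
    finally show ?thesis .
  qed
  have "norm (\<Sum>m\<in>{a..<b}. (P ^^ m) (E (f ((Q ^^ m) h)))) \<le> 2 * K * norm ((Q ^^ a) h)" for a b h
  proof (rule power2_le_imp_le)
    have "(\<Sum>m\<in>{a..<b}. (norm (E ((Q ^^ m) (Q h))))\<^sup>2) \<le> (norm ((Q ^^ a) (Q h)))\<^sup>2"
      by (rule norm_E_sum)
    also have "\<dots> \<le> (norm ((Q ^^ a) h))\<^sup>2"
      using norm_Q_pow_le(1)[of "(Q ^^ a) h"] by (simp add: funpow_swap1[symmetric])
    finally have s: "(\<Sum>m\<in>{a..<b}. (norm (E ((Q ^^ m) (Q h))))\<^sup>2) \<le> (norm ((Q ^^ a) h))\<^sup>2" .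
    have "(norm (\<Sum>m\<in>{a..<b}. (P ^^ m) (E (f ((Q ^^ m) h)))))\<^sup>2 \<le> (\<Sum>m\<in>{a..<b}. (norm (f ((Q ^^ m) h)))\<^sup>2)"
      by (rule synthesis_bound)
    also have "\<dots> \<le> (\<Sum>m\<in>{a..<b}. K\<^sup>2 * (2 * (norm (E ((Q ^^ m) h)))\<^sup>2 + 2 * (norm (E ((Q ^^ m) (Q h))))\<^sup>2))"
      by (intro sum_mono order_trans[OF f_le]) (simp add: funpow_swap1)
    also have "\<dots> = K\<^sup>2 * (2 * (\<Sum>m\<in>{a..<b}. (norm (E ((Q ^^ m) h)))\<^sup>2) + 2 * (\<Sum>m\<in>{a..<b}. (norm (E ((Q ^^ m) (Q h))))\<^sup>2))"
      by (simp add: sum.distrib flip: sum_distrib_left)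
    also have "\<dots> \<le> K\<^sup>2 * (2 * (norm ((Q ^^ a) h))\<^sup>2 + 2 * (norm ((Q ^^ a) h))\<^sup>2)"
      by (intro mult_left_mono add_mono norm_E_sum s) auto
    also have "\<dots> = (2 * K * norm ((Q ^^ a) h))\<^sup>2"
      by (simp add: power_mult_distrib)
    finally show "(norm (\<Sum>m\<in>{a..<b}. (P ^^ m) (E (f ((Q ^^ m) h)))))\<^sup>2 \<le> (2 * K * norm ((Q ^^ a) h))\<^sup>2" .
  qed (use K in \<open>simp add: K_def\<close>)
  thus ?thesis using K by (intro exI[of _ "2 * K"]) (auto simp: K_def)
qed

lemma T_LIMSEQ: "(\<lambda>n. Tn n h) \<longlonglongrightarrow> T h"
proof -
  obtain K where K: "K \<ge> 0"
    "\<And>a b h. norm (\<Sum>m\<in>{a..<b}. (P ^^ m) (E (f ((Q ^^ m) h)))) \<le> K * norm ((Q ^^ a) h)"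
    using ex_tail_bound by metis
  have lim: "(\<lambda>n. K * norm ((Q ^^ n) h)) \<longlonglongrightarrow> K * norm (0::'a)"
    by (intro tendsto_mult tendsto_const tendsto_norm pure)
  have "summable (\<lambda>m. (P ^^ m) (E (f ((Q ^^ m) h))))"
    unfolding summable_Cauchy
  proof (intro allI impI)
    fix e :: real assume "e > 0"
    then obtain N0 where "\<And>n. n \<ge> N0 \<Longrightarrow> K * norm ((Q ^^ n) h) < e"
      using order_tendstoD(2)[OF lim, of e] by (auto simp: eventually_sequentially)
    thus "\<exists>N0. \<forall>a\<ge>N0. \<forall>b. norm (\<Sum>m\<in>{a..<b}. (P ^^ m) (E (f ((Q ^^ m) h)))) < e"
      using K(2) le_less_trans by blast
  qed
  hence "convergent (\<lambda>n. Tn n h)"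
    by (simp add: Tn_def summable_iff_convergent)
  thus ?thesis by (simp add: T_def convergent_LIMSEQ_iff)
qed

lemma cbl_T: "cbl T"
  unfolding cbl_iff
proof (intro conjI allI)
  obtain K where K: "K \<ge> 0"
    "\<And>a b h. norm (\<Sum>m\<in>{a..<b}. (P ^^ m) (E (f ((Q ^^ m) h)))) \<le> K * norm ((Q ^^ a) h)"
    using ex_tail_bound by metis
  show "bounded_linear T"
  proof (rule bounded_linear_intro[where K=K])
    show "T (x + y) = T x + T y" for x y
      using tendsto_add[OF T_LIMSEQ[of x] T_LIMSEQ[of y]] T_LIMSEQ[of "x + y"]
      by (simp add: cbl_add[OF cbl_Tn] LIMSEQ_unique)
    show "T (r *\<^sub>R x) = r *\<^sub>R T x" for r x
      using tendsto_scaleR[OF tendsto_const[of r] T_LIMSEQ[of x]] T_LIMSEQ[of "r *\<^sub>R x"]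
      by (simp add: cbl_scaleR[OF cbl_Tn] LIMSEQ_unique)
    show "norm (T x) \<le> norm x * K" for x
    proof (rule Lim_bounded)
      show "(\<lambda>n. norm (Tn n x)) \<longlonglongrightarrow> norm (T x)"
        by (intro tendsto_norm T_LIMSEQ)
      show "\<forall>n\<ge>0. norm (Tn n x) \<le> norm x * K"
        using K(2)[where a=0 and h=x] by (simp add: Tn_def atLeast0LessThan mult.commute)
    qed
  qed
  show "T (cJ x) = cJ (T x)" for x
    using bounded_linear.tendsto[OF bounded_linear_cJ T_LIMSEQ[of x]] T_LIMSEQ[of "cJ x"]
    by (simp add: cbl_cJ[OF cbl_Tn] LIMSEQ_unique)
qed

lemma P_pow_Q_pow_LIMSEQ: "(\<lambda>n. (P ^^ n) ((Q ^^ n) x)) \<longlonglongrightarrow> 0"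
  by (rule tendsto_0_le[OF pure[of x], where K=1]) (simp add: norm_Q_pow_le)

text \<open>In the step \<open>theta'_Suc\<close> trades \<open>\<theta>' (Suc n) (G y)\<close> for
  terms in F' and F: the F' part telescopes into the first summand, the F part extends the sum, and
  \<open>\<theta>' n (G' y)\<close> cancels the old boundary term. The last summand compensates
  \<open>\<theta>' 0\<close> = -Q in the boundary term at n = 0.\<close>

lemma D_Tn:
  "D (Tn n h) = F' (D (h - (P ^^ n) ((Q ^^ n) h))) + F (\<Sum>m<n. \<theta>' m (E ((Q ^^ m) h)))
     + \<theta>' n (G' (E ((Q ^^ n) h))) + Q (G' (E h))"
proof (induction n)
  case 0
  show ?case by (simp add: Tn_def zero) (simp add: \<theta>'_def)
next
  case (Suc n)
  define y where "y = E ((Q ^^ n) h)"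
  have y: "y \<in> N" by (simp add: y_def E_in)
  have fy: "f ((Q ^^ n) h) = G y + G' (E ((Q ^^ Suc n) h))"
    by (simp add: f_def y_def)
  have D: "D ((P ^^ n) (E z)) = \<theta>' (Suc n) z" for z
    by (simp add: \<theta>'_def)
  have "\<theta>' (Suc n) y = D ((P ^^ n) ((Q ^^ n) h)) - D ((P ^^ Suc n) ((Q ^^ Suc n) h))"
    by (simp add: \<theta>'_def y_def EE pow_diff diff funpow_swap1)
  hence Fy: "F' (\<theta>' (Suc n) y) = F' (D ((P ^^ n) ((Q ^^ n) h))) - F' (D ((P ^^ Suc n) ((Q ^^ Suc n) h)))"
    by (simp add: diff del: funpow.simps)
  have "D (Tn (Suc n) h) = D (Tn n h) + \<theta>' (Suc n) (G y) + \<theta>' (Suc n) (G' (E ((Q ^^ Suc n) h)))"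
    by (simp add: Tn_def add pow_add D fy del: funpow.simps)
  also have "\<theta>' (Suc n) (G y) = F' (\<theta>' (Suc n) y) + F (\<theta>' n y) - \<theta>' n (G' y)"
    using theta'_Suc[OF y, of n] by (simp add: algebra_simps)
  finally show ?case
    unfolding Suc Fy
    by (simp add: y_def[symmetric] diff add algebra_simps del: funpow.simps)
qed

text \<open>Partial-sum form of the orthogonality of the model sequence to the range of
  multiplication by the characteristic function. The right side tends to 0, so the F term of
  \<open>D_Tn\<close> disappears in the limit.\<close>

lemma theta'_sum: "(\<Sum>m<Suc n. \<theta>' m (E ((Q ^^ m) h))) = - D ((P ^^ n) ((Q ^^ Suc n) h))"
proof (induction n)
  case 0
  show ?case by (simp add: \<theta>'_def QE)
next
  case (Suc n)
  have "\<theta>' (Suc n) (E ((Q ^^ Suc n) h)) = D ((P ^^ n) ((Q ^^ Suc n) h)) - D ((P ^^ Suc n) ((Q ^^ Suc (Suc n)) h))"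
    by (simp add: \<theta>'_def EE pow_diff diff funpow_swap1)
  thus ?case using Suc by (simp del: funpow.simps)
qed

lemma D_T: "D (T h) = F' (D h) + Q (G' (E h))"
proof -
  have "(\<lambda>n. D (Tn n h)) \<longlonglongrightarrow> F' (D (h - 0)) + F 0 + 0 + Q (G' (E h))"
    unfolding D_Tn
  proof (intro tendsto_add tendsto tendsto_diff tendsto_const P_pow_Q_pow_LIMSEQ)
    have "(\<lambda>n. - D ((P ^^ n) ((Q ^^ n) (Q h)))) \<longlonglongrightarrow> - D 0"
      by (intro tendsto_minus tendsto P_pow_Q_pow_LIMSEQ)
    hence "(\<lambda>n. \<Sum>m<Suc n. \<theta>' m (E ((Q ^^ m) h))) \<longlonglongrightarrow> 0"
      unfolding theta'_sum by (simp add: zero funpow_swap1)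
    thus "(\<lambda>n. \<Sum>m<n. \<theta>' m (E ((Q ^^ m) h))) \<longlonglongrightarrow> 0"
      by (rule LIMSEQ_imp_Suc)
    have "(\<lambda>n. G' (E ((Q ^^ n) h))) \<longlonglongrightarrow> G' (E 0)"
      by (intro tendsto pure)
    hence lim: "(\<lambda>n. G' (E ((Q ^^ n) h))) \<longlonglongrightarrow> 0"
      by (simp add: zero)
    obtain K1 K2 where K: "K1 > 0" "\<And>x. norm (D x) \<le> K1 * norm x" "K2 > 0" "\<And>x. norm (E x) \<le> K2 * norm x"
      using cbl_pos_bound[OF cbl(3)] cbl_pos_bound[OF cbl(4)] by auto
    \<comment> \<open>Index and argument move together in the boundary term, so a bound uniform in
      \<open>n\<close> is needed.\<close>
    have bd: "norm (\<theta>' n x) \<le> norm x * (1 + K1 * K2)" for n x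
    proof (cases n)
      case 0
      show ?thesis
        using norm_Q_pow_le(1)[of x] K by (simp add: 0 \<theta>'_def algebra_simps add_increasing2)
    next
      case (Suc k)
      have "norm (D ((P ^^ k) (E x))) \<le> K1 * norm ((P ^^ k) (E x))" by (rule K)
      also have "\<dots> \<le> K1 * (K2 * norm x)"
        using K by (intro mult_left_mono order_trans[OF norm_Q_pow_le(4)]) auto
      also have "\<dots> \<le> norm x * (1 + K1 * K2)"
        by (simp add: algebra_simps)
      finally show ?thesis by (simp add: Suc \<theta>'_def)
    qed
    show "(\<lambda>n. \<theta>' n (G' (E ((Q ^^ n) h)))) \<longlonglongrightarrow> 0"
      by (rule tendsto_0_le[OF lim, where K="1 + K1 * K2"]) (simp add: bd)
  qed
  moreover have "(\<lambda>n. D (Tn n h)) \<longlonglongrightarrow> D (T h)"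
    by (intro tendsto T_LIMSEQ)
  ultimately show ?thesis
    by (simp add: zero LIMSEQ_unique)
qed

lemma T_shift: "T h = E (f h) + P (T (Q h))"
proof -
  have "Tn (Suc n) h = E (f h) + P (Tn n (Q h))" for n
    unfolding Tn_def sum.lessThan_Suc_shift by (simp add: sum funpow_swap1)
  hence "(\<lambda>n. Tn (Suc n) h) \<longlonglongrightarrow> E (f h) + P (T (Q h))"
    by (simp only:) (intro tendsto_add tendsto_const tendsto T_LIMSEQ)
  thus ?thesis
    using LIMSEQ_Suc[OF T_LIMSEQ[of h]] LIMSEQ_unique by blast
qed

text \<open>Rewriting D Q as Q E, \<open>theta'_0\<close> turns the first term of \<open>D_T\<close>
  into Q G E h, which completes \<open>f h\<close> under Q.\<close>

lemma D_T_Q: "D (T (Q h)) = Q (f h)"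
  by (simp add: D_T f_def add theta'_0[OF E_in] flip: QE)

text \<open>With \<open>Q_T\<close> this says that the model sequence of T h is exactly the image of
  that of h under the adjoint multiplication. In \<open>T_shift\<close> the first term leaves the
  error -P Q (f h) after applying E, and \<open>D_T_Q\<close> shows that the second term restores
  it.\<close>

lemma E_T: "E (T h) = f h"
  by (subst T_shift) (simp add: add EE D_T_Q flip: PD)

lemma Q_T: "Q (T h) = T (Q h)"
proof -
  have "Q (T h) = D (Q (f h)) + Q (P (T (Q h)))"
    by (subst T_shift) (simp add: add QE)
  also have "D (Q (f h)) = T (Q h) - Q (P (T (Q h)))"
    by (simp add: DD flip: D_T_Q)
  finally show ?thesis by simp
qed

text \<open>Weak form of the fundamental equation for G. In the partial sums the terms pairing E
  (Q^(m+1) h) with E (Q^m k) cancel and the others telescope; purity removes the last one.\<close>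

lemma inner_T_diff: "inner (T h) k - inner (Q h) (T k) = inner (G (E h)) (E k)"
proof -
  have "inner (Tn n h) k - inner (Q h) (Tn n k)
      = inner (G (E h)) (E k) - inner (G (E ((Q ^^ n) h))) (E ((Q ^^ n) k))" for n
  proof (induction n)
    case (Suc n)
    have "inner (Tn (Suc n) h) k = inner (Tn n h) k + inner (f ((Q ^^ n) h)) (E ((Q ^^ n) k))"
      by (simp add: Tn_def inner_add_left PQ_pow E_sym)
    moreover have "inner (Q h) (Tn (Suc n) k) = inner (Q h) (Tn n k) + inner (E ((Q ^^ Suc n) h)) (f ((Q ^^ n) k))"
      by (simp add: Tn_def inner_add_right E_sym funpow_swap1 flip: QP_pow)
    ultimately show ?case
      using Suc by (simp add: f_def inner_add_left inner_add_right GG' G'G)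
  qed (simp add: Tn_def)
  moreover have "(\<lambda>n. inner (Tn n h) k - inner (Q h) (Tn n k)) \<longlonglongrightarrow> inner (T h) k - inner (Q h) (T k)"
    by (intro tendsto_diff tendsto_inner tendsto_const T_LIMSEQ)
  moreover have "(\<lambda>n. inner (G (E h)) (E k) - inner (G (E ((Q ^^ n) h))) (E ((Q ^^ n) k)))
      \<longlonglongrightarrow> inner (G (E h)) (E k) - inner (G (E 0)) (E 0)"
    by (intro tendsto_diff tendsto_inner tendsto_const tendsto pure)
  ultimately show ?thesis
    by (simp add: zero LIMSEQ_unique)
qed

section \<open>The operator S and the two fundamental equations\<close>

definition S where "S = adj T"

lemma cbl_S: "cbl S"
  by (simp add: S_def cbl_adj cbl_T)

lemma adj_S: "adj S = T"
  by (simp add: S_def adj_adj cbl_T)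

lemma ST: "inner (S x) y = inner x (T y)"
  by (simp add: S_def inner_adj_left cbl_T)

lemma TS: "inner (T x) y = inner x (S y)"
  by (metis ST inner_commute)

lemma fundamental_G: "T x - S (Q x) = E (G (E x))"
  by (rule inner_ext) (simp add: inner_diff_left ST inner_T_diff E_sym)

lemma S_eq: "S x = P (T x) + E (G' (E x))"
proof (rule inner_ext)
  fix y
  have "inner (S x) y = inner x (S (Q y) + E (G (E y)))"
    by (simp add: ST flip: fundamental_G)
  also have "\<dots> = inner (P (T x) + E (G' (E x))) y"
    by (simp add: inner_add_left inner_add_right PQ E_sym G'G flip: TS)
  finally show "inner (S x) y = inner (P (T x) + E (G' (E x))) y" .
qed

text \<open>The adjoint equation is the one checked: inserting \<open>S_eq\<close> in T - Q S gives
  D (D T - Q G' E), and by \<open>D_T\<close> the bracket is F' D.\<close>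

lemma fundamental_F: "S x - T (P x) = D (F (D x))"
proof (rule inner_ext)
  fix y
  have "T y - Q (S y) = D (D (T y)) - D (Q (G' (E y)))"
    by (simp add: S_eq add DD QE)
  also have "\<dots> = D (F' (D y))"
    by (simp add: D_T add)
  finally have "inner x (T y - Q (S y)) = inner x (D (F' (D y)))" by simp
  thus "inner (S x - T (P x)) y = inner (D (F (D x))) y"
    by (simp add: inner_diff_left inner_diff_right ST TS PQ D_sym FF')
qed

lemma S_P: "S (P x) = P (S x)"
  by (rule inner_ext) (simp add: ST PQ Q_T)

text \<open>The adjoint of \<open>E_T\<close>. Extended to all powers of P, it says that the
  synthesis map carries multiplication by G' + G z to S.\<close>

lemma S_E: "S (E e) = E (G' e) + P (E (G e))"
  by (rule inner_ext) (simp add: ST E_sym E_T f_def inner_add_left inner_add_right PQ G'G GG')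

lemma S_P_pow_E: "S ((P ^^ n) (E e)) = (P ^^ n) (E (G' e)) + (P ^^ Suc n) (E (G e))"
proof -
  have "S ((P ^^ n) (E e)) = (P ^^ n) (S (E e))"
    by (rule funpow_intertwine) (rule S_P)
  thus ?thesis by (simp add: S_E pow_add funpow_swap1)
qed

end

subsection \<open>Polynomials in a self-adjoint operator\<close>

definition poly_op :: "complex poly \<Rightarrow> ('a::chilbert \<Rightarrow> 'a) \<Rightarrow> 'a \<Rightarrow> 'a" where
  "poly_op p A x = (\<Sum>i\<le>degree p. scaleC (coeff p i) ((A ^^ i) x))"

lemma poly_op_eq_sum:
  assumes "degree p \<le> n"
  shows "poly_op p A x = (\<Sum>i\<le>n. scaleC (coeff p i) ((A ^^ i) x))"
  unfolding poly_op_def using assms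
  by (intro sum.mono_neutral_left) (auto simp: coeff_eq_0)

lemma poly_op_0 [simp]: "poly_op 0 A x = 0"
  by (simp add: poly_op_def)

lemma poly_op_add: "poly_op (p + q) A x = poly_op p A x + poly_op q A x"
proof -
  define n where "n = max (degree p) (degree q)"
  have "degree (p + q) \<le> n" "degree p \<le> n" "degree q \<le> n"
    unfolding n_def by (simp_all add: degree_add_le_max)
  thus ?thesis
    by (simp add: poly_op_eq_sum[where n=n] scaleC.scale_left_distrib sum.distrib)
qed

lemma poly_op_smult: "poly_op (smult c p) A x = scaleC c (poly_op p A x)"
  by (simp add: poly_op_eq_sum[OF degree_smult_le] poly_op_def scaleC.scale_sum_right)

context
  fixes A :: "'a::chilbert \<Rightarrow> 'a"
  assumes A: "cbl A"
begin

lemma poly_op_pCons: "poly_op (pCons a p) A x = scaleC a x + A (poly_op p A x)"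
proof -
  have "poly_op (pCons a p) A x = (\<Sum>i\<le>Suc (degree p). scaleC (coeff (pCons a p) i) ((A ^^ i) x))"
    by (rule poly_op_eq_sum) (rule degree_pCons_le)
  also have "\<dots> = scaleC a x + (\<Sum>i\<le>degree p. scaleC (coeff p i) (A ((A ^^ i) x)))"
    by (simp add: sum.atMost_Suc_shift del: sum.atMost_Suc)
  finally show ?thesis
    by (simp add: poly_op_def cbl_sum[OF A] cbl_scaleC[OF A])
qed

lemma poly_op_mult: "poly_op (p * q) A x = poly_op p A (poly_op q A x)"
  by (induction p) (simp_all add: poly_op_pCons poly_op_add poly_op_smult)

lemma cbl_poly_op: "cbl (poly_op p A)"
proof -
  have "cbl (\<lambda>x. \<Sum>i\<le>degree p. scaleC (coeff p i) ((A ^^ i) x))"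
    by (intro cbl_sum_fun cbl_scaleC_compose cbl_funpow A) auto
  thus ?thesis unfolding poly_op_def[abs_def] .
qed

text \<open>Splitting off one linear factor at a time writes p(A) as a product of maps bounded
  below. This stands in for the spectral mapping theorem.\<close>

lemma poly_op_bounded_below:
  assumes "p \<noteq> 0" "\<And>\<mu>. poly p \<mu> = 0 \<Longrightarrow> \<exists>\<delta>>0. \<forall>x. \<delta> * norm x \<le> norm (A x - scaleC \<mu> x)"
  shows "\<exists>\<delta>>0. \<forall>x. \<delta> * norm x \<le> norm (poly_op p A x)"
  using assms
proof (induction "degree p" arbitrary: p)
  case 0
  then obtain a where p: "p = [:a:]" using degree_eq_zeroE by metis
  have "cmod a > 0" using 0 by (simp add: p)
  moreover have "norm (poly_op p A x) = cmod a * norm x" for x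
    by (simp add: p poly_op_pCons cbl_zero[OF A] norm_scaleC)
  ultimately show ?case by (intro exI[of _ "cmod a"]) auto
next
  case (Suc n)
  have "\<not> constant (poly p)"
    using Suc(2) by (simp add: constant_degree)
  then obtain \<mu> where \<mu>: "poly p \<mu> = 0"
    using fundamental_theorem_of_algebra by blast
  then obtain q where q: "p = [:-\<mu>, 1:] * q"
    by (meson dvdE poly_eq_0_iff_dvd)
  have q0: "q \<noteq> 0" using Suc.prems(1) q by auto
  have "degree p = degree [:-\<mu>, 1:] + degree q"
    unfolding q using q0 by (intro degree_mult_eq) auto
  hence n: "n = degree q" using Suc(2) by simp
  have "\<exists>\<delta>>0. \<forall>x. \<delta> * norm x \<le> norm (A x - scaleC \<nu> x)" if "poly q \<nu> = 0" for \<nu>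
    using Suc.prems(2)[of \<nu>] that by (simp add: q)
  then obtain \<delta> where \<delta>: "\<delta> > 0" "\<And>x. \<delta> * norm x \<le> norm (poly_op q A x)"
    using Suc.hyps(1)[OF n q0] by blast
  obtain \<epsilon> where \<epsilon>: "\<epsilon> > 0" "\<And>x. \<epsilon> * norm x \<le> norm (A x - scaleC \<mu> x)"
    using Suc.prems(2)[OF \<mu>] by blast
  have "\<epsilon> * \<delta> * norm x \<le> norm (poly_op p A x)" for x
  proof -
    have "\<epsilon> * \<delta> * norm x \<le> \<epsilon> * norm (poly_op q A x)"
      using \<delta>(2)[of x] \<epsilon>(1) by simp
    also have "\<dots> \<le> norm (A (poly_op q A x) - scaleC \<mu> (poly_op q A x))"
      by (rule \<epsilon>)
    also have "A (poly_op q A x) - scaleC \<mu> (poly_op q A x) = poly_op p A x"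
      unfolding q poly_op_mult by (simp add: poly_op_pCons cbl_zero[OF A] scaleC.scale_minus_left)
    finally show ?thesis .
  qed
  moreover have "\<epsilon> * \<delta> > 0" using \<epsilon>(1) \<delta>(1) by simp
  ultimately show ?case by blast
qed

context
  assumes A_sym: "\<And>x y. inner (A x) y = inner x (A y)"
begin

lemma poly_op_adjoint: "inner (poly_op p A x) y = inner x (poly_op (map_poly cnj p) A y)"
proof (induction p arbitrary: x y)
  case (pCons a p)
  have "poly_op (map_poly cnj p) A (A y) = A (poly_op (map_poly cnj p) A y)" for y
    using poly_op_mult[of "map_poly cnj p" "[:0, 1:]" y] poly_op_mult[of "[:0, 1:]" "map_poly cnj p" y]
    by (simp add: poly_op_pCons cbl_zero[OF A] mult.commute)
  thus ?case
    using pCons by (simp add: map_poly_pCons poly_op_pCons inner_add_left inner_add_right A_sym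
        inner_scaleC_left)
qed simp

text \<open>Quantitative form of the spectrum lying in [-r, r]. For real \<open>\<mu>\<close>,
  Cauchy-Schwarz against x gives the margin \<open>\<bar>Re \<mu>\<bar> - r\<close>; otherwise (A -
  Re \<mu>) x is orthogonal to \<open>cJ x\<close>, and Pythagoras gives
  \<open>\<bar>Im \<mu>\<bar>\<close>.\<close>

lemma shift_bounded_below:
  assumes A_le: "\<And>x. \<bar>inner (A x) x\<bar> \<le> r * (norm x)\<^sup>2" and \<mu>: "Im \<mu> \<noteq> 0 \<or> \<bar>Re \<mu>\<bar> > r"
  shows "\<exists>\<delta>>0. \<forall>x. \<delta> * norm x \<le> norm (A x - scaleC \<mu> x)"
proof (cases "Im \<mu> = 0")
  case True
  hence \<mu>r: "scaleC \<mu> x = Re \<mu> *\<^sub>R x" for x by (simp add: scaleC_def)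
  have "(\<bar>Re \<mu>\<bar> - r) * norm x \<le> norm (A x - scaleC \<mu> x)" for x
  proof (cases "x = 0")
    case False
    have "(\<bar>Re \<mu>\<bar> - r) * (norm x)\<^sup>2 \<le> \<bar>inner (A x - scaleC \<mu> x) x\<bar>"
      using A_le[of x] by (simp add: \<mu>r inner_diff_left algebra_simps abs_mult flip: power2_norm_eq_inner)
    also have "\<dots> \<le> norm (A x - scaleC \<mu> x) * norm x"
      by (rule Cauchy_Schwarz_ineq2)
    finally show ?thesis using False by (simp add: power2_eq_square)
  qed (simp add: cbl_zero[OF A])
  thus ?thesis using \<mu> True by (intro exI[of _ "\<bar>Re \<mu>\<bar> - r"]) auto
next
  case False
  have "\<bar>Im \<mu>\<bar> * norm x \<le> norm (A x - scaleC \<mu> x)" for x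
  proof (rule power2_le_imp_le)
    define u where "u = A x - Re \<mu> *\<^sub>R x"
    have "inner (A x) (cJ x) = inner (cJ (A x)) x"
      by (simp add: A_sym cbl_cJ[OF A] inner_commute)
    hence "inner (A x) (cJ x) = 0" by (simp add: inner_cJ_left)
    hence 0: "inner u (cJ x) = 0" by (simp add: u_def inner_diff_left)
    have "A x - scaleC \<mu> x = u - Im \<mu> *\<^sub>R cJ x" by (simp add: u_def scaleC_def)
    hence "(norm (A x - scaleC \<mu> x))\<^sup>2 = (norm u)\<^sup>2 + (Im \<mu>)\<^sup>2 * (norm x)\<^sup>2"
      using 0 unfolding power2_norm_eq_inner
      by (simp add: inner_diff_left inner_diff_right inner_commute[of "cJ x" u] cJ_inner power2_eq_square)
    thus "(\<bar>Im \<mu>\<bar> * norm x)\<^sup>2 \<le> (norm (A x - scaleC \<mu> x))\<^sup>2"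
      by (simp add: power_mult_distrib)
  qed simp
  thus ?thesis using False by (intro exI[of _ "\<bar>Im \<mu>\<bar>"]) auto
qed

text \<open>Suppose B = q(A) has norm l > K. Then p = l^2 - cnj(q) q has no zero in [-r, r], so p(A)
  = l^2 - B' B is bounded below by some \<delta> > 0. Expanding the square of |p(A) x| gives |B x|^2
  \<le> (l^2 - \<delta>^2 / l^2) |x|^2, against the choice of l as the norm.\<close>

lemma norm_poly_op_le:
  assumes A_le: "\<And>x. \<bar>inner (A x) x\<bar> \<le> r * (norm x)\<^sup>2" and r: "r \<ge> 0"
    and K: "\<And>t. \<bar>t\<bar> \<le> r \<Longrightarrow> cmod (poly q (of_real t)) \<le> K"
  shows "norm (poly_op q A x) \<le> K * norm x"
proof -
  define B where "B = poly_op q A"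
  define B' where "B' = poly_op (map_poly cnj q) A"
  define l where "l = onorm B"
  have B: "cbl B" "bounded_linear B" and BB': "\<And>x y. inner (B x) y = inner x (B' y)"
    unfolding B_def B'_def by (simp_all add: cbl_poly_op cbl_bounded_linear poly_op_adjoint)
  have K0: "K \<ge> 0" using order_trans[OF norm_ge_zero K[of 0]] r by simp
  have B_le: "norm (B x) \<le> l * norm x" for x
    unfolding l_def by (rule onorm) (rule B)
  have B'_le: "norm (B' x) \<le> l * norm x" for x
    using norm_adj_le[OF B(1) B_le] adj_eqI[OF B(1) BB'] by simp
  have "l \<le> K"
  proof (rule ccontr)
    assume "\<not> l \<le> K"
    hence l: "l > K" "l > 0" using K0 by auto
    have l2: "K\<^sup>2 < l\<^sup>2" using l K0 by (intro power_strict_mono) auto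
    define p where "p = [:of_real (l\<^sup>2):] - map_poly cnj q * q"
    have cnj_poly: "poly (map_poly cnj q) (of_real t) = cnj (poly q (of_real t))" for t
      by (induction q) (simp_all add: map_poly_pCons)
    have nz: "poly p (of_real t) \<noteq> 0" if "\<bar>t\<bar> \<le> r" for t
    proof
      assume "poly p (of_real t) = 0"
      hence "of_real (l\<^sup>2) = cnj (poly q (of_real t)) * poly q (of_real t)"
        by (simp add: p_def cnj_poly)
      hence "complex_of_real (l\<^sup>2) = of_real ((cmod (poly q (of_real t)))\<^sup>2)"
        by (metis complex_norm_square mult.commute)
      hence "l\<^sup>2 = (cmod (poly q (of_real t)))\<^sup>2"
        using of_real_eq_iff by blast
      also have "\<dots> \<le> K\<^sup>2" using K[OF that] by (intro power_mono) auto
      finally show False using l2 by simp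
    qed
    have "\<exists>\<delta>>0. \<forall>x. \<delta> * norm x \<le> norm (poly_op p A x)"
    proof (rule poly_op_bounded_below)
      show "p \<noteq> 0" using nz[of 0] r by auto
      fix \<mu> assume "poly p \<mu> = 0"
      hence "Im \<mu> \<noteq> 0 \<or> \<bar>Re \<mu>\<bar> > r"
        using nz[of "Re \<mu>"] by (cases "Im \<mu> = 0") (auto simp: complex_is_Real_iff of_real_Re not_le[symmetric])
      thus "\<exists>\<delta>>0. \<forall>x. \<delta> * norm x \<le> norm (A x - scaleC \<mu> x)"
        by (rule shift_bounded_below[OF A_le])
    qed
    then obtain \<delta> where \<delta>: "\<delta> > 0" "\<And>x. \<delta> * norm x \<le> norm (poly_op p A x)" by blast
    have pop: "poly_op p A x = l\<^sup>2 *\<^sub>R x - B' (B x)" for x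
    proof -
      have "poly_op p A x + poly_op (map_poly cnj q * q) A x = poly_op [:of_real (l\<^sup>2):] A x"
        unfolding poly_op_add[symmetric] p_def by simp
      moreover have "poly_op [:of_real (l\<^sup>2):] A x = l\<^sup>2 *\<^sub>R x"
        by (simp add: poly_op_pCons cbl_zero[OF A] del: of_real_power)
      ultimately show ?thesis by (simp add: poly_op_mult B_def B'_def eq_diff_eq)
    qed
    have expand: "(norm (b *\<^sub>R x - w))\<^sup>2 = b * b * (norm x)\<^sup>2 - 2 * b * inner x w + (norm w)\<^sup>2"
      for b and x w :: 'a
      unfolding power2_norm_eq_inner
      by (simp add: inner_diff_left inner_diff_right inner_commute[of w x] algebra_simps)
    have main: "(norm (B x))\<^sup>2 \<le> (l\<^sup>2 - \<delta>\<^sup>2 / l\<^sup>2) * (norm x)\<^sup>2" for x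
    proof -
      have "\<delta>\<^sup>2 * (norm x)\<^sup>2 \<le> (norm (poly_op p A x))\<^sup>2"
        using power_mono[OF \<delta>(2), of x 2] \<delta>(1) by (simp add: power_mult_distrib)
      also have "\<dots> = l\<^sup>2 * l\<^sup>2 * (norm x)\<^sup>2 - 2 * l\<^sup>2 * (norm (B x))\<^sup>2 + (norm (B' (B x)))\<^sup>2"
        unfolding pop expand BB'[symmetric] power2_norm_eq_inner[symmetric] ..
      also have "(norm (B' (B x)))\<^sup>2 \<le> l\<^sup>2 * (norm (B x))\<^sup>2"
        using power_mono[OF B'_le[of "B x"], of 2] by (simp add: power_mult_distrib)
      finally have "l\<^sup>2 * (norm (B x))\<^sup>2 \<le> l\<^sup>2 * l\<^sup>2 * (norm x)\<^sup>2 - \<delta>\<^sup>2 * (norm x)\<^sup>2" by simp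
      thus ?thesis using l by (simp add: field_simps)
    qed
    \<comment> \<open>The \<open>max\<close> makes the square root legitimate; both candidates
      remain below l^2.\<close>
    define s where "s = max 0 (l\<^sup>2 - \<delta>\<^sup>2 / l\<^sup>2)"
    have "norm (B x) \<le> sqrt s * norm x" for x
    proof (rule power2_le_imp_le)
      have "(norm (B x))\<^sup>2 \<le> s * (norm x)\<^sup>2"
        using main[of x] mult_right_mono[of "l\<^sup>2 - \<delta>\<^sup>2 / l\<^sup>2" s "(norm x)\<^sup>2"] by (simp add: s_def)
      thus "(norm (B x))\<^sup>2 \<le> (sqrt s * norm x)\<^sup>2"
        by (simp add: power_mult_distrib s_def)
    qed (simp add: s_def)
    hence "l \<le> sqrt s"
      unfolding l_def by (intro onorm_bound) (simp_all add: s_def)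
    hence "l\<^sup>2 \<le> s"
      using power_mono[of l "sqrt s" 2] l(2) by (simp add: s_def)
    moreover have "s < l\<^sup>2" using l \<delta>(1) by (simp add: s_def)
    ultimately show False by simp
  qed
  thus ?thesis
    using B_le[of x] mult_right_mono[of l K "norm x"] by (simp add: B_def)
qed

end

end

subsection \<open>The spectral set estimate\<close>

lemma poly2_eval_le_sup:
  assumes "(s, p) \<in> Gamma_set"
  shows "cmod (poly2_eval c N s p) \<le> poly2_sup c N"
proof -
  have "bdd_above ((\<lambda>(s, p). cmod (poly2_eval c N s p)) ` Gamma_set)"
  proof (rule bdd_aboveI2[where M="\<Sum>i\<le>N. \<Sum>j\<le>N. cmod (c i j) * 2 ^ i"], clarify)
    fix s p assume "(s, p) \<in> Gamma_set"
    then obtain z1 z2 where z: "s = z1 + z2" "p = z1 * z2" "cmod z1 \<le> 1" "cmod z2 \<le> 1"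
      by (auto simp: Gamma_set_def)
    have s: "cmod s \<le> 2" using z norm_triangle_ineq[of z1 z2] by simp
    have p: "cmod p \<le> 1" using z by (simp add: norm_mult mult_le_one)
    have "cmod (c i j * s ^ i * p ^ j) \<le> cmod (c i j) * 2 ^ i" for i j
    proof -
      have "cmod s ^ i * cmod p ^ j \<le> 2 ^ i * 1"
        using s p by (intro mult_mono power_mono power_le_one) auto
      thus ?thesis
        using mult_left_mono[of "cmod s ^ i * cmod p ^ j" "2 ^ i" "cmod (c i j)"]
        by (simp add: norm_mult norm_power mult.assoc)
    qed
    thus "cmod (poly2_eval c N s p) \<le> (\<Sum>i\<le>N. \<Sum>j\<le>N. cmod (c i j) * 2 ^ i)"
      unfolding poly2_eval_def by (intro sum_norm_le)
  qed
  thus ?thesis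
    unfolding poly2_sup_def using assms by (intro cSup_upper) (auto intro!: image_eqI[of _ _ "(s, p)"])
qed

lemma poly2_sup_nonneg: "0 \<le> poly2_sup c N"
proof -
  have "(0, 0) \<in> Gamma_set" by (force simp: Gamma_set_def)
  thus ?thesis using poly2_eval_le_sup norm_ge_zero order_trans by blast
qed

text \<open>Writing \<open>\<omega> = \<zeta>\<^sup>2\<close>, the operator \<open>G' + \<omega> G\<close> is \<open>\<zeta>\<close> times a self-adjoint operator with spectrum
  in \<open>[-2, 2]\<close>, and \<open>(\<zeta> t, \<omega>)\<close> lies in \<open>\<Gamma>\<close> for \<open>t = 2 cos \<alpha>\<close>.\<close>

lemma norm_poly2_pencil_le:
  fixes G G' :: "'a::chilbert \<Rightarrow> 'a"
  assumes G: "cbl G" "cbl G'" "\<And>x y. inner (G x) y = inner x (G' y)"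
    and w: "\<And>x. cmod (cinner (G x) x) \<le> (norm x)\<^sup>2" and \<omega>: "cmod \<omega> = 1"
  shows "norm (poly2_op c N (\<lambda>x. G' x + scaleC \<omega> (G x)) (scaleC \<omega>) x) \<le> poly2_sup c N * norm x"
proof -
  define \<zeta> where "\<zeta> = csqrt \<omega>"
  have \<zeta>2: "\<zeta> * \<zeta> = \<omega>" by (simp add: \<zeta>_def flip: power2_eq_square)
  hence "cmod \<zeta> * cmod \<zeta> = 1" using \<omega> by (simp flip: norm_mult)
  hence \<zeta>: "cmod \<zeta> = 1" by (metis norm_ge_zero power2_eq_1_iff power2_eq_square zero_le_one neg_0_le_iff_le not_one_le_zero)
  have \<zeta>c: "\<zeta> * cnj \<zeta> = 1" using \<zeta> by (simp add: complex_norm_square[symmetric])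
  define A where "A v = scaleC (cnj \<zeta>) (G' v) + scaleC \<zeta> (G v)" for v
  have cA: "cbl A" unfolding A_def by (intro cbl_plus cbl_scaleC_compose G)
  have G'G: "inner (G' x) y = inner x (G y)" for x y
    by (metis G(3) inner_commute)
  have A_sym: "inner (A x) y = inner x (A y)" for x y
    by (simp add: A_def inner_add_left inner_add_right inner_scaleC_left cbl_scaleC[OF G(1)]
        cbl_scaleC[OF G(2)] G'G G(3))
  have A_le: "\<bar>inner (A x) x\<bar> \<le> 2 * (norm x)\<^sup>2" for x
  proof -
    have "inner (scaleC (cnj \<zeta>) (G' x)) x = inner x (scaleC \<zeta> (G x))"
      by (simp add: inner_scaleC_left G'G cbl_scaleC[OF G(1)])
    also have "\<dots> = inner (scaleC \<zeta> (G x)) x"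
      by (rule inner_commute)
    finally have "inner (scaleC (cnj \<zeta>) (G' x)) x = inner (scaleC \<zeta> (G x)) x" .
    hence "inner (A x) x = 2 * Re (\<zeta> * cinner (G x) x)"
      by (simp add: A_def inner_add_left) (simp add: scaleC_def cinner_def inner_add_left inner_cJ_left)
    moreover have "\<bar>Re (\<zeta> * cinner (G x) x)\<bar> \<le> cmod (\<zeta> * cinner (G x) x)"
      by (rule abs_Re_le_cmod)
    ultimately show ?thesis using w[of x] \<zeta> by (simp add: norm_mult)
  qed
  have pencil: "G' v + scaleC \<omega> (G v) = scaleC \<zeta> (A v)" for v
    using \<zeta>c \<zeta>2 by (simp add: A_def scaleC.scale_right_distrib)
  have pow1: "((\<lambda>x. G' x + scaleC \<omega> (G x)) ^^ i) v = scaleC (\<zeta> ^ i) ((A ^^ i) v)" for i v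
    unfolding pencil by (induction i) (simp_all add: cbl_scaleC[OF cA])
  have pow2: "(scaleC \<omega> ^^ j) v = scaleC (\<omega> ^ j) v" for j and v :: 'a
    by (induction j) simp_all
  \<comment> \<open>With \<open>\<zeta>\<close> and \<open>\<omega>\<close> fixed, their powers are
    absorbed in the coefficients. The two-variable polynomial becomes \<open>q\<close> in the
    self-adjoint A, and q(t) is its value at (\<zeta> t, \<omega>).\<close>
  define a where "a i = (\<Sum>j\<le>N. c i j * \<zeta> ^ i * \<omega> ^ j)" for i
  define q where "q = (\<Sum>i\<le>N. monom (a i) i)"
  have "degree q \<le> N"
    unfolding q_def by (intro degree_sum_le) (auto intro: order_trans[OF degree_monom_le])
  moreover have "coeff q i = a i" if "i \<le> N" for i
    using that by (simp add: q_def coeff_sum)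
  ultimately have "poly_op q A x = (\<Sum>i\<le>N. scaleC (a i) ((A ^^ i) x))"
    by (simp add: poly_op_eq_sum)
  also have "\<dots> = poly2_op c N (\<lambda>x. G' x + scaleC \<omega> (G x)) (scaleC \<omega>) x"
    unfolding poly2_op_def pow1 pow2
    by (simp add: a_def scaleC.scale_sum_left cbl_scaleC[OF cbl_funpow[OF cA]] mult_ac)
  finally have eq: "poly2_op c N (\<lambda>x. G' x + scaleC \<omega> (G x)) (scaleC \<omega>) x = poly_op q A x" ..
  show ?thesis
    unfolding eq
  proof (rule norm_poly_op_le[OF cA A_sym A_le])
    fix t :: real assume t: "\<bar>t\<bar> \<le> 2"
    define \<alpha> where "\<alpha> = arccos (t / 2)"
    have cos: "2 * cos \<alpha> = t" using t by (simp add: \<alpha>_def cos_arccos_abs)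
    have "\<zeta> * of_real t = \<zeta> * cis \<alpha> + \<zeta> * cis (- \<alpha>)"
      by (simp add: complex_eq_iff flip: cos)
    moreover have "\<omega> = (\<zeta> * cis \<alpha>) * (\<zeta> * cis (- \<alpha>))"
      using \<zeta>2 by (simp add: mult_ac cis_mult)
    moreover have "cmod (\<zeta> * cis \<alpha>) \<le> 1" "cmod (\<zeta> * cis (- \<alpha>)) \<le> 1"
      using \<zeta> by (simp_all add: norm_mult)
    ultimately have "(\<zeta> * of_real t, \<omega>) \<in> Gamma_set"
      unfolding Gamma_set_def by blast
    moreover have "poly q (of_real t) = poly2_eval c N (\<zeta> * of_real t) \<omega>"
      by (simp add: q_def poly_sum poly_monom poly2_eval_def a_def sum_distrib_right
          power_mult_distrib) (simp add: mult_ac)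
    ultimately show "cmod (poly q (of_real t)) \<le> poly2_sup c N"
      using poly2_eval_le_sup by simp
  qed simp
qed

text \<open>A geometric sum of powers of an L-th root of unity. Both indices lie below L, so their
  difference is a multiple of L only when it is 0.\<close>

lemma sum_roots_of_unity:
  fixes n m L :: nat
  assumes "n < L" "m < L"
  shows "(\<Sum>k<L. cis (2 * pi * real k / real L) ^ n * cnj (cis (2 * pi * real k / real L)) ^ m)
    = (if n = m then of_nat L else 0)"
proof -
  define \<theta> where "\<theta> = 2 * pi * (real n - real m) / real L"
  have L: "real L > 0" using assms by simp
  have pw: "cis (2 * pi * real k / real L) ^ n * cnj (cis (2 * pi * real k / real L)) ^ m = cis \<theta> ^ k" for k
    by (simp add: cis_cnj Complex.DeMoivre cis_mult \<theta>_def field_simps diff_divide_distrib)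
  have "cis \<theta> = 1" if "n = m" using that by (simp add: \<theta>_def)
  moreover have "(\<Sum>k<L. cis \<theta> ^ k) = 0" if "n \<noteq> m"
  proof -
    have "cis \<theta> \<noteq> 1"
    proof
      assume "cis \<theta> = 1"
      hence "cos \<theta> = 1" by (metis cis.sel(1) one_complex.sel(1))
      then obtain j :: int where j: "\<theta> = real_of_int j * 2 * pi" using cos_one_2pi_int[of \<theta>] by blast
      hence "(2 * pi) * (real n - real m) = (2 * pi) * (real_of_int j * real L)"
        using L by (simp add: \<theta>_def field_simps)
      hence "real n - real m = real_of_int j * real L"
        unfolding mult_cancel_left using pi_gt_zero by simp
      hence "int n - int m = j * int L" by (metis of_int_diff of_int_eq_iff of_int_mult of_int_of_nat_eq)
      moreover have "\<bar>int n - int m\<bar> < int L" using assms by linarith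
      ultimately have "\<bar>j\<bar> * int L < 1 * int L" by (simp add: abs_mult)
      hence "j = 0" using L by (simp add: mult_less_cancel_right)
      thus False using \<open>int n - int m = j * int L\<close> that by simp
    qed
    moreover have "cis \<theta> ^ L = 1"
    proof -
      have "cis \<theta> ^ L = cis (2 * pi * of_int (int n - int m))"
        using L by (simp add: Complex.DeMoivre \<theta>_def)
      thus ?thesis by (metis cis_multiple_2pi Ints_of_int)
    qed
    ultimately show ?thesis by (simp add: sum_gp_strict)
  qed
  ultimately show ?thesis unfolding pw by auto
qed

text \<open>For coefficients with indices below L, averaging over the L-th roots of unity is exact,
  so no integral over the circle is needed.\<close>

lemma discrete_parseval:
  fixes f :: "nat \<Rightarrow> 'a::chilbert"
  shows "(\<Sum>k<L. (norm (\<Sum>n<L. scaleC (cis (2 * pi * real k / real L) ^ n) (f n)))\<^sup>2)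
    = real L * (\<Sum>n<L. (norm (f n))\<^sup>2)"
proof -
  define z where "z k = cis (2 * pi * real k / real L)" for k
  have "(norm (\<Sum>n<L. scaleC (z k ^ n) (f n)))\<^sup>2
      = (\<Sum>n<L. \<Sum>m<L. inner (scaleC (z k ^ n * cnj (z k) ^ m) (f n)) (f m))" for k
    unfolding power2_norm_eq_inner inner_sum_left unfolding inner_sum_right inner_scaleC_right
    by (simp add: mult.commute)
  hence "(\<Sum>k<L. (norm (\<Sum>n<L. scaleC (z k ^ n) (f n)))\<^sup>2)
      = (\<Sum>k<L. \<Sum>n<L. \<Sum>m<L. inner (scaleC (z k ^ n * cnj (z k) ^ m) (f n)) (f m))"
    by simp
  also have "\<dots> = (\<Sum>n<L. \<Sum>k<L. \<Sum>m<L. inner (scaleC (z k ^ n * cnj (z k) ^ m) (f n)) (f m))"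
    by (rule sum.swap)
  also have "\<dots> = (\<Sum>n<L. \<Sum>m<L. \<Sum>k<L. inner (scaleC (z k ^ n * cnj (z k) ^ m) (f n)) (f m))"
    by (intro sum.cong refl sum.swap)
  also have "\<dots> = (\<Sum>n<L. \<Sum>m<L. inner (scaleC (if n = m then of_nat L else 0) (f n)) (f m))"
    by (intro sum.cong refl) (simp add: z_def sum_roots_of_unity flip: inner_sum_left scaleC.scale_sum_left)
  also have "\<dots> = (\<Sum>n<L. \<Sum>m<L. if n = m then real L * (norm (f n))\<^sup>2 else 0)"
    by (intro sum.cong refl) (auto simp: scaleC_def power2_norm_eq_inner)
  finally show ?thesis by (simp add: z_def sum_distrib_left)
qed

text \<open>A vector polynomial \<open>\<Sum> f n z^n\<close> is a finitely supported sequence, on which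
  \<open>toeplitz\<close> is multiplication by \<open>G' + z G\<close> and \<open>shift\<close> multiplication by \<open>z\<close>.\<close>

definition shift :: "(nat \<Rightarrow> 'a::zero) \<Rightarrow> nat \<Rightarrow> 'a" where
  "shift f n = (case n of 0 \<Rightarrow> 0 | Suc m \<Rightarrow> f m)"

definition toeplitz :: "('a \<Rightarrow> 'a) \<Rightarrow> ('a \<Rightarrow> 'a) \<Rightarrow> (nat \<Rightarrow> 'a) \<Rightarrow> nat \<Rightarrow> 'a::{zero,plus}" where
  "toeplitz G G' f n = G' (f n) + G (shift f n)"

text \<open>Used twice: with \<open>V n\<close> = P^n E, where (A, B) is (S, P), and with
  \<open>V n\<close> the scalar z^n, where the sum is evaluation at z. Each shift and each
  multiplication enlarges the support by at most one, so truncation at L \<ge> d + 2N loses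
  nothing.\<close>

lemma poly2_intertwine:
  fixes V :: "nat \<Rightarrow> 'a::chilbert \<Rightarrow> 'a"
  assumes G: "cbl G" "cbl G'" and V: "\<And>n. cbl (V n)" and AB: "cbl A" "cbl B"
    and VA: "\<And>n e. A (V n e) = V n (G' e) + V (Suc n) (G e)"
    and VB: "\<And>n e. B (V n e) = V (Suc n) e"
    and f: "\<And>n. n \<ge> d \<Longrightarrow> f n = 0" and L: "d + 2 * N \<le> L"
  shows "(\<Sum>n<L. V n (\<Sum>i\<le>N. \<Sum>j\<le>N. scaleC (c i j) ((toeplitz G G' ^^ i) ((shift ^^ j) f) n)))
    = poly2_op c N A B (\<Sum>n<L. V n (f n))"
proof -
  define W where "W f = (\<Sum>n<L. V n (f n))" for f
  have W_shift: "W (shift g) = B (W g)" if g: "\<And>n. n \<ge> e \<Longrightarrow> g n = 0" and e: "e < L" for g e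
  proof -
    obtain L' where L': "L = Suc L'" using e by (cases L) auto
    have "W (shift g) = (\<Sum>m<L'. V (Suc m) (g m))"
      unfolding W_def L' sum.lessThan_Suc_shift by (simp add: shift_def cbl_zero[OF V])
    also have "\<dots> = B (W g)"
      unfolding W_def L' using g[of L'] e L' by (simp add: cbl_sum[OF AB(2)] VB cbl_zero[OF V] cbl_add[OF AB(2)])
    finally show ?thesis .
  qed
  have W_toep: "W (toeplitz G G' g) = A (W g)" if g: "\<And>n. n \<ge> e \<Longrightarrow> g n = 0" and e: "e < L" for g e
  proof -
    obtain L' where L': "L = Suc L'" using e by (cases L) auto
    have "(\<Sum>n<L. V n (G (shift g n))) = (\<Sum>m<L'. V (Suc m) (G (g m)))"
      unfolding L' sum.lessThan_Suc_shift by (simp add: shift_def cbl_zero[OF V] cbl_zero[OF G(1)])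
    also have "\<dots> = (\<Sum>m<L. V (Suc m) (G (g m)))"
      unfolding L' using g[of L'] e L' by (simp add: cbl_zero[OF V] cbl_zero[OF G(1)])
    finally show ?thesis
      by (simp add: W_def toeplitz_def cbl_add[OF V] sum.distrib cbl_sum[OF AB(1)] VA)
  qed
  have shift_supp: "(shift ^^ j) f n = 0" if "n \<ge> d + j" for j n
    using that by (induction j arbitrary: n) (auto simp: f shift_def split: nat.split)
  have toep_supp: "(toeplitz G G' ^^ i) ((shift ^^ j) f) n = 0" if "n \<ge> d + j + i" for i j n
    using that
    by (induction i arbitrary: n)
      (auto simp: shift_supp toeplitz_def shift_def cbl_zero[OF G(1)] cbl_zero[OF G(2)] split: nat.split)
  have W_shifts: "W ((shift ^^ j) f) = (B ^^ j) (W f)" if "d + j \<le> L" for j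
    using that by (induction j) (simp_all add: W_shift[where e="d + _", OF shift_supp])
  have W_toeps: "W ((toeplitz G G' ^^ i) ((shift ^^ j) f)) = (A ^^ i) ((B ^^ j) (W f))" if "d + j + i \<le> L" for i j
    using that by (induction i) (simp_all add: W_shifts W_toep[where e="d + j + _", OF toep_supp])
  have "(\<Sum>n<L. V n (\<Sum>i\<le>N. \<Sum>j\<le>N. scaleC (c i j) ((toeplitz G G' ^^ i) ((shift ^^ j) f) n)))
      = (\<Sum>n<L. \<Sum>i\<le>N. \<Sum>j\<le>N. scaleC (c i j) (V n ((toeplitz G G' ^^ i) ((shift ^^ j) f) n)))"
    by (simp add: cbl_sum[OF V] cbl_scaleC[OF V])
  also have "\<dots> = (\<Sum>i\<le>N. \<Sum>n<L. \<Sum>j\<le>N. scaleC (c i j) (V n ((toeplitz G G' ^^ i) ((shift ^^ j) f) n)))"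
    by (rule sum.swap)
  also have "\<dots> = (\<Sum>i\<le>N. \<Sum>j\<le>N. \<Sum>n<L. scaleC (c i j) (V n ((toeplitz G G' ^^ i) ((shift ^^ j) f) n)))"
    by (intro sum.cong refl sum.swap)
  also have "\<dots> = (\<Sum>i\<le>N. \<Sum>j\<le>N. scaleC (c i j) (W ((toeplitz G G' ^^ i) ((shift ^^ j) f))))"
    by (simp add: W_def scaleC.scale_sum_right)
  also have "\<dots> = poly2_op c N A B (W f)"
    unfolding poly2_op_def using L by (intro sum.cong refl) (simp add: W_toeps)
  finally show ?thesis by (simp add: W_def)
qed

section \<open>The von Neumann inequality for the pair\<close>

lemma cbl_poly2_op:
  assumes "cbl S" "cbl P"
  shows "cbl (poly2_op c N S P)"
proof -
  have "cbl (\<lambda>x. \<Sum>i\<le>N. \<Sum>j\<le>N. scaleC (c i j) ((S ^^ i) ((P ^^ j) x)))"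
    by (intro cbl_sum_fun cbl_scaleC_compose cbl_compose[OF cbl_funpow[OF assms(1)] cbl_funpow[OF assms(2)]]) auto
  thus ?thesis unfolding poly2_op_def[abs_def] .
qed

context pure_intertwining
begin

text \<open>Contractivity of the synthesis reduces the claim to the coefficients \<open>g\<close>.
  Parseval passes to values at roots of unity, where \<open>norm_poly2_pencil_le\<close> applies
  pointwise, and Parseval again returns to \<open>u\<close>.\<close>

lemma poly2_synthesis_le:
  assumes w: "\<And>x. cmod (cinner (G x) x) \<le> (norm x)\<^sup>2"
    and u: "\<And>n. n \<ge> d \<Longrightarrow> u n = 0"
  shows "(norm (poly2_op c k S P (\<Sum>n<d. (P ^^ n) (E (u n)))))\<^sup>2 \<le> (poly2_sup c k)\<^sup>2 * (\<Sum>n<d. (norm (u n))\<^sup>2)"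
proof -
  \<comment> \<open>Room for the 2k enlargements of the support; the \<open>Suc\<close> makes L
    positive, so that it can be cancelled at the end.\<close>
  define L where "L = Suc (d + 2 * k)"
  define g where "g n = (\<Sum>i\<le>k. \<Sum>j\<le>k. scaleC (c i j) ((toeplitz G G' ^^ i) ((shift ^^ j) u) n))" for n
  define z where "z m = cis (2 * pi * real m / real L)" for m
  define ev where "ev h m = (\<Sum>n<L. scaleC (z m ^ n) (h n))" for h :: "nat \<Rightarrow> 'a" and m
  have ext: "(\<Sum>n<d. U n) = (\<Sum>n<L. U n)" if "\<And>n. n \<ge> d \<Longrightarrow> U n = 0" for U :: "nat \<Rightarrow> 'b::comm_monoid_add"
    using that by (intro sum.mono_neutral_left) (auto simp: L_def)
  have W: "(\<Sum>n<d. (P ^^ n) (E (u n))) = (\<Sum>n<L. (P ^^ n) (E (u n)))"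
    by (rule ext) (simp add: u zero pow_zero)
  have cV: "cbl (\<lambda>e. (P ^^ n) (E e))" for n
    by (rule cbl_compose[OF cbl_pow(1) cbl(4)])
  have "(\<Sum>n<L. (P ^^ n) (E (g n))) = poly2_op c k S P (\<Sum>n<L. (P ^^ n) (E (u n)))"
    unfolding g_def
    by (rule poly2_intertwine[where V="\<lambda>n e. (P ^^ n) (E e)" and d=d])
      (simp_all add: L_def cbl cV cbl_S u S_P_pow_E)
  hence 1: "(norm (poly2_op c k S P (\<Sum>n<d. (P ^^ n) (E (u n)))))\<^sup>2 \<le> (\<Sum>n<L. (norm (g n))\<^sup>2)"
    using synthesis_bound[where a=0 and b=L and g=g] by (simp add: W atLeast0LessThan)
  have ev_g: "ev g m = poly2_op c k (\<lambda>x. G' x + scaleC (z m) (G x)) (scaleC (z m)) (ev u m)" for m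
    unfolding ev_def g_def
  proof (rule poly2_intertwine[where V="\<lambda>n. scaleC (z m ^ n)" and d=d])
    show "cbl (scaleC (z m ^ n))" for n
      using cbl_scaleC_compose[OF cbl_id, of "z m ^ n"] .
    show "cbl (\<lambda>x. G' x + scaleC (z m) (G x))"
      by (intro cbl_plus cbl_scaleC_compose cbl)
    show "cbl (scaleC (z m))"
      using cbl_scaleC_compose[OF cbl_id, of "z m"] .
  qed (simp_all add: L_def cbl u cbl_scaleC[OF cbl(7)] cbl_scaleC[OF cbl(8)] mult.commute)
  have "real L * (\<Sum>n<L. (norm (g n))\<^sup>2) = (\<Sum>m<L. (norm (ev g m))\<^sup>2)"
    unfolding ev_def z_def by (rule discrete_parseval[symmetric])
  also have "\<dots> \<le> (\<Sum>m<L. (poly2_sup c k * norm (ev u m))\<^sup>2)"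
    unfolding ev_g
    by (intro sum_mono power_mono norm_poly2_pencil_le[OF cbl(7,8) GG' w]) (simp_all add: z_def)
  also have "\<dots> = (poly2_sup c k)\<^sup>2 * (\<Sum>m<L. (norm (ev u m))\<^sup>2)"
    by (simp add: power_mult_distrib sum_distrib_left)
  also have "(\<Sum>m<L. (norm (ev u m))\<^sup>2) = real L * (\<Sum>n<L. (norm (u n))\<^sup>2)"
    unfolding ev_def z_def by (rule discrete_parseval)
  also have "(\<Sum>n<L. (norm (u n))\<^sup>2) = (\<Sum>n<d. (norm (u n))\<^sup>2)"
    by (rule ext[symmetric]) (simp add: u)
  finally have "real L * (\<Sum>n<L. (norm (g n))\<^sup>2) \<le> real L * ((poly2_sup c k)\<^sup>2 * (\<Sum>n<d. (norm (u n))\<^sup>2))"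
    by (simp add: mult_ac)
  hence "(\<Sum>n<L. (norm (g n))\<^sup>2) \<le> (poly2_sup c k)\<^sup>2 * (\<Sum>n<d. (norm (u n))\<^sup>2)"
    by (simp add: L_def del: of_nat_Suc)
  with 1 show ?thesis by linarith
qed

text \<open>\<open>X d\<close> synthesises the first d model coefficients of x. It telescopes to x -
  P^d Q^d x and so tends to x, while \<open>norm_E_sum\<close> bounds the coefficients uniformly in
  d.\<close>

lemma gamma_contraction_S_P:
  assumes w: "\<And>x. cmod (cinner (G x) x) \<le> (norm x)\<^sup>2"
  shows "gamma_contraction S P"
  unfolding gamma_contraction_def
proof (intro conjI allI cbl_S cbl(1) S_P)
  fix c k x
  define X where "X d = (\<Sum>n<d. (P ^^ n) (E (E ((Q ^^ n) x))))" for d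
  have X: "X d = x - (P ^^ d) ((Q ^^ d) x)" for d
    by (induction d) (simp_all add: X_def EE pow_diff funpow_swap1)
  have le: "norm (poly2_op c k S P (X d)) \<le> poly2_sup c k * norm x" for d
  proof (rule power2_le_imp_le)
    define g where "g n = (if n < d then E ((Q ^^ n) x) else 0)" for n
    have "X d = (\<Sum>n<d. (P ^^ n) (E (g n)))"
      by (simp add: X_def g_def)
    hence "(norm (poly2_op c k S P (X d)))\<^sup>2 \<le> (poly2_sup c k)\<^sup>2 * (\<Sum>n<d. (norm (g n))\<^sup>2)"
      using poly2_synthesis_le[OF w, of d g c k] by (simp add: g_def)
    also have "(\<Sum>n<d. (norm (g n))\<^sup>2) \<le> (norm x)\<^sup>2"
      using norm_E_sum[where a=0 and b=d and x=x] by (simp add: g_def atLeast0LessThan)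
    finally show "(norm (poly2_op c k S P (X d)))\<^sup>2 \<le> (poly2_sup c k * norm x)\<^sup>2"
      by (simp add: power_mult_distrib mult_left_mono)
  qed (simp add: poly2_sup_nonneg)
  have "X \<longlonglongrightarrow> x - 0"
    unfolding X[abs_def] by (intro tendsto_diff tendsto_const P_pow_Q_pow_LIMSEQ)
  hence "(\<lambda>d. norm (poly2_op c k S P (X d))) \<longlonglongrightarrow> norm (poly2_op c k S P (x - 0))"
    by (intro tendsto_norm cbl_tendsto[OF cbl_poly2_op[OF cbl_S cbl(1)]])
  thus "norm (poly2_op c k S P x) \<le> poly2_sup c k * norm x"
    using le by (auto intro: Lim_bounded)
qed

end

subsection \<open>Taylor coefficients of the characteristic function\<close>

text \<open>The point t = 0 is excluded so that the induction may divide by t; the constant term is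
  recovered as a limit.\<close>

lemma powser_zero_coeff:
  fixes a :: "nat \<Rightarrow> real"
  assumes "\<And>t. t \<noteq> 0 \<Longrightarrow> \<bar>t\<bar> < 1 \<Longrightarrow> (\<lambda>n. a n * t ^ n) sums 0"
  shows "a n = 0"
  using assms
proof (induction n arbitrary: a)
  have a0: "a 0 = 0" if "\<And>t. t \<noteq> 0 \<Longrightarrow> \<bar>t\<bar> < 1 \<Longrightarrow> (\<lambda>n. a n * t ^ n) sums 0" for a :: "nat \<Rightarrow> real"
  proof -
    have "((\<lambda>t::real. 0::real) \<longlongrightarrow> a 0) (at 0)"
      by (rule powser_limit_0_strong[where s=1]) (use that in auto)
    thus ?thesis using tendsto_const_iff[of "at (0::real)" "0::real" "a 0"] by simp
  qed
  case 0
  show ?case by (rule a0) (rule 0)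
  case (Suc n)
  show ?case
  proof (rule Suc.IH[of "\<lambda>n. a (Suc n)"])
    fix t :: real assume t: "t \<noteq> 0" "\<bar>t\<bar> < 1"
    have "(\<lambda>n. a (Suc n) * t ^ Suc n) sums 0"
      using Suc.prems[OF t] a0[OF Suc.prems] by (subst sums_Suc_iff) simp
    from sums_divide[OF this, of t] show "(\<lambda>n. a (Suc n) * t ^ n) sums 0"
      using t by simp
  qed
qed

text \<open>The \<open>inv\<close> in \<open>char_fun\<close> needs a unique preimage: the Neumann
  series provides one, and \<bar>t\<bar> < 1 gives injectivity. Real t suffice because the
  coefficients of a power series are determined on (-1, 1).\<close>

lemma inv_resolvent_sums:
  fixes Q :: "'a::chilbert \<Rightarrow> 'a"
  assumes Q: "contraction Q" and t: "\<bar>t\<bar> < 1"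
  shows "(\<lambda>n. t ^ n *\<^sub>R (Q ^^ n) v) sums inv (\<lambda>y. y - t *\<^sub>R Q y) v"
proof -
  have cQ: "cbl Q" and le: "\<And>x. norm (Q x) \<le> norm x"
    using Q by (auto simp: contraction_def)
  have le_pow: "norm ((Q ^^ n) v) \<le> norm v" for n
    by (induction n) (auto intro: order_trans[OF le])
  have sm: "summable (\<lambda>n. t ^ n *\<^sub>R (Q ^^ n) v)"
  proof (rule summable_comparison_test'[where N=0])
    show "summable (\<lambda>n. \<bar>t\<bar> ^ n * norm v)"
      using t by (intro summable_mult2 summable_geometric) simp
    show "norm (t ^ n *\<^sub>R (Q ^^ n) v) \<le> \<bar>t\<bar> ^ n * norm v" for n
      using le_pow[of n] by (simp add: power_abs mult_left_mono)
  qed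
  define r where "r = (\<Sum>n. t ^ n *\<^sub>R (Q ^^ n) v)"
  have "t *\<^sub>R Q r = (\<Sum>n. t *\<^sub>R Q (t ^ n *\<^sub>R (Q ^^ n) v))"
    unfolding r_def bounded_linear.suminf[OF cbl_bounded_linear[OF cQ] sm]
    by (rule suminf_scaleR_right) (rule bounded_linear.summable[OF cbl_bounded_linear[OF cQ] sm])
  also have "\<dots> = (\<Sum>n. t ^ Suc n *\<^sub>R (Q ^^ Suc n) v)"
    by (simp add: cbl_scaleR[OF cQ])
  also have "\<dots> = r - v"
    unfolding r_def using suminf_split_head[OF sm] by simp
  finally have rv: "r - t *\<^sub>R Q r = v" by simp
  have "inj (\<lambda>y. y - t *\<^sub>R Q y)"
  proof (rule injI)
    fix x y assume "x - t *\<^sub>R Q x = y - t *\<^sub>R Q y"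
    hence "x - y = t *\<^sub>R Q (x - y)" by (simp add: cbl_diff[OF cQ] algebra_simps)
    hence "norm (x - y) = \<bar>t\<bar> * norm (Q (x - y))" by (metis norm_scaleR)
    also have "\<dots> \<le> \<bar>t\<bar> * norm (x - y)" by (intro mult_left_mono le) auto
    finally have "(1 - \<bar>t\<bar>) * norm (x - y) \<le> 0" by (simp add: algebra_simps)
    thus "x = y" using t by (simp add: mult_le_0_iff)
  qed
  hence "inv (\<lambda>y. y - t *\<^sub>R Q y) v = r" using rv by (rule inv_f_eq)
  thus ?thesis using sm by (simp add: r_def summable_sums)
qed

definition char_coeff :: "('a::chilbert \<Rightarrow> 'a) \<Rightarrow> nat \<Rightarrow> 'a \<Rightarrow> 'a" where
  "char_coeff P n x = (case n of 0 \<Rightarrow> - P x | Suc k \<Rightarrow> defect (adj P) ((adj P ^^ k) (defect P x)))"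

lemma char_fun_sums:
  assumes P: "contraction P" and t: "\<bar>t\<bar> < 1"
  shows "(\<lambda>n. t ^ n *\<^sub>R char_coeff P n x) sums char_fun P (of_real t) x"
proof -
  let ?E = "defect (adj P)" and ?Q = "adj P"
  have Q: "contraction ?Q" by (rule contraction_adj[OF P])
  have cE: "cbl ?E" by (rule cbl_defect[OF Q])
  define r where "r = inv (\<lambda>y. y - t *\<^sub>R ?Q y) (defect P x)"
  have "(\<lambda>n. t ^ n *\<^sub>R (?Q ^^ n) (defect P x)) sums r"
    unfolding r_def by (rule inv_resolvent_sums[OF Q t])
  hence "(\<lambda>n. t *\<^sub>R ?E (t ^ n *\<^sub>R (?Q ^^ n) (defect P x))) sums (t *\<^sub>R ?E r)"
    by (intro sums_scaleR_right bounded_linear.sums[OF cbl_bounded_linear[OF cE]])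
  hence "(\<lambda>n. t ^ Suc n *\<^sub>R char_coeff P (Suc n) x) sums (t *\<^sub>R ?E r)"
    by (simp add: char_coeff_def cbl_scaleR[OF cE])
  hence "(\<lambda>n. t ^ n *\<^sub>R char_coeff P n x) sums (t *\<^sub>R ?E r + t ^ 0 *\<^sub>R char_coeff P 0 x)"
    by (rule sums_Suc)
  thus ?thesis by (simp add: char_fun_def char_coeff_def r_def)
qed

lemma cbl_char_coeff:
  assumes P: "contraction P"
  shows "cbl (char_coeff P n)"
proof (cases n)
  case 0
  show ?thesis
    using cbl_scaleC_compose[of P "-1"] P by (simp add: 0 char_coeff_def[abs_def] contraction_def)
next
  case (Suc k)
  have "cbl (\<lambda>x. defect (adj P) ((adj P ^^ k) (defect P x)))"
    using P by (intro cbl_compose[OF cbl_defect[OF contraction_adj[OF P]]]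
        cbl_compose[OF cbl_funpow cbl_defect]) (simp_all add: contraction_def cbl_adj)
  thus ?thesis by (simp add: Suc char_coeff_def[abs_def])
qed

text \<open>Used with u = F x and v the adjoint of F at x. The \<open>a n\<close> are the Taylor
  coefficients of the difference of the two sides; pairing with a fixed y leaves a scalar real
  series.\<close>

lemma char_coeff_intertwining:
  assumes P: "contraction P" and G: "cbl G" "cbl G'"
    and eq: "\<And>t. \<bar>t\<bar> < 1 \<Longrightarrow> char_fun P (of_real t) (u + t *\<^sub>R v)
      = G' (char_fun P (of_real t) x) + t *\<^sub>R G (char_fun P (of_real t) x)"
  shows "char_coeff P 0 u = G' (char_coeff P 0 x)"
    and "char_coeff P (Suc n) u + char_coeff P n v = G' (char_coeff P (Suc n) x) + G (char_coeff P n x)"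
proof -
  define \<theta> where "\<theta> = char_coeff P"
  define a where "a n = \<theta> n u - G' (\<theta> n x) + (case n of 0 \<Rightarrow> 0 | Suc k \<Rightarrow> \<theta> k v - G (\<theta> k x))" for n
  have sums0: "(\<lambda>n. t ^ n *\<^sub>R a n) sums 0" if t: "\<bar>t\<bar> < 1" for t
  proof -
    note S = char_fun_sums[OF P t, folded \<theta>_def]
    have 1: "(\<lambda>n. t ^ n *\<^sub>R (\<theta> n u - G' (\<theta> n x))) sums
        (char_fun P (of_real t) u - G' (char_fun P (of_real t) x))"
      using sums_diff[OF S[of u] bounded_linear.sums[OF cbl_bounded_linear[OF G(2)] S[of x]]]
      by (simp add: cbl_scaleR[OF G(2)] scaleR_diff_right)
    have "(\<lambda>n. t *\<^sub>R (t ^ n *\<^sub>R (\<theta> n v - G (\<theta> n x)))) sums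
        (t *\<^sub>R (char_fun P (of_real t) v - G (char_fun P (of_real t) x)))"
      using sums_diff[OF S[of v] bounded_linear.sums[OF cbl_bounded_linear[OF G(1)] S[of x]]]
      by (intro sums_scaleR_right) (simp add: cbl_scaleR[OF G(1)] scaleR_diff_right)
    hence "(\<lambda>n. t ^ Suc n *\<^sub>R (case Suc n of 0 \<Rightarrow> 0 | Suc k \<Rightarrow> \<theta> k v - G (\<theta> k x))) sums
        (t *\<^sub>R (char_fun P (of_real t) v - G (char_fun P (of_real t) x)))"
      by simp
    from sums_Suc[OF this]
    have 2: "(\<lambda>n. t ^ n *\<^sub>R (case n of 0 \<Rightarrow> 0 | Suc k \<Rightarrow> \<theta> k v - G (\<theta> k x))) sums
        (t *\<^sub>R (char_fun P (of_real t) v - G (char_fun P (of_real t) x)))"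
      by simp
    \<comment> \<open>Linearity of \<open>char_fun\<close> in the vector is read off from the
      series, since the definition hides it behind \<open>inv\<close>.\<close>
    have "(\<lambda>n. t ^ n *\<^sub>R \<theta> n u + t *\<^sub>R (t ^ n *\<^sub>R \<theta> n v)) sums
        (char_fun P (of_real t) u + t *\<^sub>R char_fun P (of_real t) v)"
      by (intro sums_add sums_scaleR_right S)
    moreover have "t ^ n *\<^sub>R \<theta> n (u + t *\<^sub>R v) = t ^ n *\<^sub>R \<theta> n u + t *\<^sub>R (t ^ n *\<^sub>R \<theta> n v)" for n
      by (simp add: \<theta>_def cbl_add[OF cbl_char_coeff[OF P]] cbl_scaleR[OF cbl_char_coeff[OF P]]
          scaleR_add_right mult.commute)
    ultimately have "char_fun P (of_real t) (u + t *\<^sub>R v)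
        = char_fun P (of_real t) u + t *\<^sub>R char_fun P (of_real t) v"
      using sums_unique2[OF S[of "u + t *\<^sub>R v"]] by simp
    hence "char_fun P (of_real t) u - G' (char_fun P (of_real t) x)
        + t *\<^sub>R (char_fun P (of_real t) v - G (char_fun P (of_real t) x)) = 0"
      using eq[OF t] by (simp add: scaleR_diff_right algebra_simps)
    thus ?thesis
      using sums_add[OF 1 2] by (simp add: a_def scaleR_add_right)
  qed
  have a: "a n = 0" for n
  proof (rule inner_ext)
    fix y
    have "inner (a n) y = 0"
    proof (rule powser_zero_coeff[of "\<lambda>n. inner (a n) y"])
      fix t :: real assume "\<bar>t\<bar> < 1"
      from bounded_linear.sums[OF bounded_linear_inner_left sums0[OF this], of y]
      show "(\<lambda>n. inner (a n) y * t ^ n) sums 0" by (simp add: mult.commute)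
    qed
    thus "inner (a n) y = inner 0 y" by simp
  qed
  show "char_coeff P 0 u = G' (char_coeff P 0 x)"
    using a[of 0] by (simp add: a_def \<theta>_def)
  show "char_coeff P (Suc n) u + char_coeff P n v = G' (char_coeff P (Suc n) x) + G (char_coeff P n x)"
    using a[of "Suc n"] by (simp add: a_def \<theta>_def algebra_simps)
qed

section \<open>Passage from the defect spaces to operators on the whole space\<close>

theorem theorem2:
  fixes P F G :: "'a::chilbert \<Rightarrow> 'a"
  assumes "pure_contraction P"
    and "sub_op (defect_space P) F"
    and "sub_op (defect_space (adj P)) G"
    and "num_radius (defect_space P) F \<le> 1"
    and "num_radius (defect_space (adj P)) G \<le> 1"
    and "\<forall>z. cmod z < 1 \<longrightarrow> (\<forall>x\<in>defect_space P.
           char_fun P z (F x + scaleC z (sub_adj (defect_space P) F x))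
         = sub_adj (defect_space (adj P)) G (char_fun P z x) + scaleC z (G (char_fun P z x)))"
  shows "\<exists>S. gamma_contraction S P \<and> fund_op S P F \<and> fund_op (adj S) (adj P) G"
proof -
  define M N where "M = defect_space P" and "N = defect_space (adj P)"
  define F1 G1 where "F1 = (\<lambda>x. F (proj M x))" and "G1 = (\<lambda>x. G (proj N x))"
  have P: "contraction P" and pure: "\<And>x. (\<lambda>n. (adj P ^^ n) x) \<longlonglongrightarrow> 0"
    using assms(1) by (auto simp: pure_contraction_def)
  have Q: "contraction (adj P)" by (rule contraction_adj[OF P])
  have cP: "cbl P" using P by (simp add: contraction_def)
  have QQ: "adj (adj P) = P" by (rule adj_adj[OF cP])
  have M: "csubspace M" and N: "csubspace N"
    unfolding M_def N_def by (rule csubspace_defect_space[OF P] csubspace_defect_space[OF Q])+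
  have F: "sub_op M F" and G: "sub_op N G"
    using assms(2,3) by (simp_all add: M_def N_def)
  have cF: "cbl F1" and cG: "cbl G1"
    unfolding F1_def G1_def by (rule cbl_extension[OF M F] cbl_extension[OF N G])+
  have rel: "char_fun P (of_real t) (F1 x + t *\<^sub>R adj F1 x)
      = adj G1 (char_fun P (of_real t) x) + t *\<^sub>R G1 (char_fun P (of_real t) x)"
    if t: "\<bar>t\<bar> < 1" and x: "x \<in> M" for t x
  proof -
    \<comment> \<open>\<open>G\<close> is replaced by its extension on N only, so the value of the
      characteristic function has to be located there: its coefficients lie in N, and N is
      closed.\<close>
    have cl: "closed N" and sub: "subspace N" using N by (simp_all add: csubspace_def)
    have "t ^ n *\<^sub>R char_coeff P n x \<in> N" for n
    proof (cases n)
      case 0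
      have "P x \<in> N"
        using contraction_maps_defect_space[OF P] x by (simp add: M_def N_def)
      thus ?thesis using sub by (simp add: 0 char_coeff_def subspace_neg)
    next
      case (Suc k)
      thus ?thesis
        using sub by (simp add: char_coeff_def subspace_scale N_def defect_in[OF Q])
    qed
    hence "(\<Sum>n<k. t ^ n *\<^sub>R char_coeff P n x) \<in> N" for k
      by (intro subspace_sum[OF sub])
    hence inN: "char_fun P (of_real t) x \<in> N"
      by (rule closed_sequentially[OF cl _ char_fun_sums[OF P t, of x, unfolded sums_def]])
    have "cmod (of_real t) < 1" using t by simp
    hence "char_fun P (of_real t) (F x + scaleC (of_real t) (sub_adj M F x))
         = sub_adj N G (char_fun P (of_real t) x) + scaleC (of_real t) (G (char_fun P (of_real t) x))"
      using assms(6) x unfolding M_def N_def by blast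
    thus ?thesis
      using extension_eq[OF M F x] extension_eq[OF N G inN]
      by (simp add: F1_def G1_def sub_adj_extension[OF M F] sub_adj_extension[OF N G])
  qed
  note coeff = char_coeff_intertwining[OF P cG cbl_adj[OF cG] rel]
  interpret pure_intertwining P "adj P" "defect P" "defect (adj P)" F1 "adj F1" G1 "adj G1" M N
    "char_coeff P"
  proof (unfold_locales)
    show "char_coeff P 0 (F1 x) = adj G1 (char_coeff P 0 x)" if "x \<in> M" for x
      using that by (intro coeff(1))
    show "char_coeff P (Suc n) (F1 x) + char_coeff P n (adj F1 x)
        = adj G1 (char_coeff P (Suc n) x) + G1 (char_coeff P n x)" if "x \<in> M" for n x
      using that by (intro coeff(2))
    show "y \<in> N \<Longrightarrow> adj P y \<in> M" for y
      using contraction_maps_defect_space[OF Q] by (simp add: M_def N_def QQ)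
    show "defect P x \<in> M" "defect (adj P) x \<in> N" for x
      by (simp_all add: M_def N_def defect_in P Q)
    show "F1 x \<in> M" "adj F1 x \<in> M" "G1 x \<in> N" "adj G1 x \<in> N" for x
      unfolding F1_def G1_def
      by (rule extension_in[OF M F] adj_extension_in[OF M F] extension_in[OF N G] adj_extension_in[OF N G])+
    show "P (defect P x) = defect (adj P) (P x)" "adj P (defect (adj P) x) = defect P (adj P x)" for x
      using defect_intertwine[OF P] defect_intertwine[OF Q] by (simp_all add: QQ)
    show "defect P (defect P x) = x - adj P (P x)"
      "defect (adj P) (defect (adj P) x) = x - P (adj P x)" for x
      by (simp_all add: defect_defect P Q QQ)
    show "inner (defect P x) y = inner x (defect P y)"
      "inner (defect (adj P) x) y = inner x (defect (adj P) y)" for x y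
      by (simp_all add: defect_sym P Q)
  qed (simp_all add: char_coeff_def P Q cP cF cG cbl_adj cbl_defect inner_adj_right M N pure)
  have "cmod (cinner (G1 x) x) \<le> (norm x)\<^sup>2" for x
    unfolding G1_def using num_radius_extension[OF N G] assms(5) by (simp add: N_def)
  hence "gamma_contraction S P"
    by (rule gamma_contraction_S_P)
  \<comment> \<open>The fundamental equations hold for the extensions and evaluate them only on
    ranges of defect operators, where they agree with F and G.\<close>
  moreover have "F1 (defect P x) = F (defect P x)" for x
    using extension_eq[OF M F, of "defect P x"] D_in by (simp add: F1_def)
  hence "fund_op S P F"
    using assms(2) fundamental_F by (simp add: fund_op_def adj_S)
  moreover have "G1 (defect (adj P) x) = G (defect (adj P) x)" for x
    using extension_eq[OF N G, of "defect (adj P) x"] E_in by (simp add: G1_def)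
  hence "fund_op (adj S) (adj P) G"
    using assms(3) fundamental_G adj_adj[OF cbl_S] by (simp add: fund_op_def adj_S)
  ultimately show ?thesis by blast
qed

end
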